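(* There exists an absolute constant $c$ such that the following holds. Let $d,n\in\mathbf N$, let $X,X_1,\ldots,X_n$ be i.i.d. real random variables with $p(1)=\mathbf P(|X_1-X_2|>1)>0$ (here $X_1,X_2$ are independent copies of $X$), let $a=(a_1,\ldots,a_n)\in(\mathbf R^d)^n$, $a\neq0$, and let $F_a^{(j)}$ be the distribution of the $j$-th coordinate of $S_a=\sum_{k=1}^nX_ka_k$. Let $\tau_j\ge\delta_j\ge0$ and $q_j=Q(F_a^{(j)},\tau_j)$, $j=1,\ldots,d$. Then there exist numbers $r_1,\ldots,r_d\in\mathbf N$ and vectors $u^{(j)}=(u^{(j)}_1,\ldots,u^{(j)}_{r_j})\in\mathbf R^{r_j}$, $j=1,\ldots,d$, such that $$R=\sum_{j=1}^dr_j\le c\sum_{j=1}^d\bigl(|\log q_j|+\log(\tau_j/\delta_j)+1\bigr)$$ and $$p(1)\,M^*\Bigl\{\mathbf R^d\setminus\times_{j=1}^d[K_1(u^{(j)})]_{\delta_j}\Bigr\}\le c\sum_{j=1}^d\bigl(|\log q_j|+\log(\tau_j/\delta_j)+1\bigr)^3,$$ where $M^*=\sum_{k=1}^n(E_{a_k}+E_{-a_k})$. Furthermore, the set $\times_{j=1}^dK_1(u^{(j)})$ can be represented as $K_1(u)$ with $u=(u_1,\ldots,u_R)\in(\mathbf R^d)^R$, where the vectors $u_s\in\mathbf R^d$, $s=1,\ldots,R$, have only one non-zero coordinate each: with $s_0=0$ and $s_k=\sum_{j=1}^kr_j$, $k=1,\ldots,d$, for $s_{k-1}<s\le s_k$ the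 vectors $u_s$ are non-zero in the $k$-th coordinate only, and these $k$-th coordinates are equal to the sequence of coordinates $u^{(k)}_1,\ldots,u^{(k)}_{r_k}$ of the vector $u^{(k)}$ (i.e. the $k$-th coordinate of $u_s$ is $u^{(k)}_{s-s_{k-1}}$).
   Context: For a probability distribution $F=\mathcal L(Y)$ on $\mathbf R$ and $\lambda\ge0$, the concentration function is $Q(F,\lambda)=\sup_{x\in\mathbf R}\mathbf P(Y\in[x-\lambda/2,x+\lambda/2])$. $E_b$ is the probability distribution concentrated at the point $b$. $[B]_\delta$ denotes the closed $\delta$-neighborhood of a set $B\subset\mathbf R$, and $\times$ denotes the direct (Cartesian) product of sets. For $r\in\mathbf N$, a dimension $d'\ge 1$ and $u=(u_1,\ldots,u_r)\in(\mathbf R^{d'})^r$, $$K_1(u)=\Bigl\{\sum_{j=1}^rn_ju_j:\ n_j\in\{-1,0,1\}\text{ for }j=1,\ldots,r\Bigr\}\subset\mathbf R^{d'}$$ (so $K_1(u^{(j)})\subset\mathbf R$, with $d'=1$). Conventions: $\log(\tau_j/\delta_j)=0$ if $\tau_j=\delta_j=0$; $\log(\tau_j/\delta_j)=+\infty$ if $\tau_j>0=\delta_j$; $|\log 0|=+\infty$. *)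

theory Defs
  imports "HOL-Probability.Probability"
begin

(* R^d with its Borel structure is the product of d copies of R over the index set {1..d}; a vector
   is a function nat => real that is "undefined" outside {1..d}.  The dimension is a number and not a
   type, so that it can be quantified after the absolute constant. *)

abbreviation Rd :: "nat \<Rightarrow> (nat \<Rightarrow> real) measure" where
  "Rd d \<equiv> Pi\<^sub>M {1..d} (\<lambda>_. borel)"

definition vneg :: "nat \<Rightarrow> (nat \<Rightarrow> real) \<Rightarrow> nat \<Rightarrow> real" where
  "vneg d x = (\<lambda>i\<in>{1..d}. - x i)"

definition conc_fun :: "real measure \<Rightarrow> real \<Rightarrow> real" where
  "conc_fun F l = (SUP x. measure F {x - l / 2 .. x + l / 2})"

(* P(|X_1 - X_2| > t) for independent X_1, X_2 with common distribution F *)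
definition diff_tail :: "real measure \<Rightarrow> real \<Rightarrow> real" where
  "diff_tail F t = measure (F \<Otimes>\<^sub>M F) {(x, y). \<bar>x - y\<bar> > t}"

(* S_a as a function of the sample (x_1, ..., x_n) *)
definition weighted_sum :: "nat \<Rightarrow> nat \<Rightarrow> (nat \<Rightarrow> nat \<Rightarrow> real) \<Rightarrow> (nat \<Rightarrow> real) \<Rightarrow> nat \<Rightarrow> real" where
  "weighted_sum d n a x = (\<lambda>i\<in>{1..d}. \<Sum>k=1..n. x k * a k i)"

(* F_a^(j), for X_1, ..., X_n realised as the coordinates of the n-fold product of the law F of X.
   By coord_law_of_iid below, every other i.i.d. realisation gives the same distribution; working
   with the law keeps the absolute constant independent of the type of the sample space. *)
definition coord_law :: "real measure \<Rightarrow> nat \<Rightarrow> nat \<Rightarrow> (nat \<Rightarrow> nat \<Rightarrow> real) \<Rightarrow> nat \<Rightarrow> real measure" where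
  "coord_law F d n a j = distr (Pi\<^sub>M {1..n} (\<lambda>_. F)) borel (\<lambda>x. weighted_sum d n a x j)"

(* K_1 for d' = 1, with R^1 identified with R *)
definition K1_real :: "nat \<Rightarrow> (nat \<Rightarrow> real) \<Rightarrow> real set" where
  "K1_real r u = {\<Sum>j=1..r. real_of_int (m j) * u j | m. m \<in> {1..r} \<rightarrow> {-1, 0, 1 :: int}}"

definition K1 :: "nat \<Rightarrow> nat \<Rightarrow> (nat \<Rightarrow> nat \<Rightarrow> real) \<Rightarrow> (nat \<Rightarrow> real) set" where
  "K1 d r u = {(\<lambda>i\<in>{1..d}. \<Sum>j=1..r. real_of_int (m j) * u j i) | m. m \<in> {1..r} \<rightarrow> {-1, 0, 1 :: int}}"

(* meant for nonempty B only, since infdist x {} = 0 *)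
definition nbhd :: "real set \<Rightarrow> real \<Rightarrow> real set" where
  "nbhd B t = {x. infdist x B \<le> t}"

definition Mstar :: "nat \<Rightarrow> nat \<Rightarrow> (nat \<Rightarrow> nat \<Rightarrow> real) \<Rightarrow> (nat \<Rightarrow> real) set \<Rightarrow> real" where
  "Mstar d n a B =
     (\<Sum>k=1..n. measure (return (Rd d) (a k)) B + measure (return (Rd d) (vneg d (a k))) B)"

(* |log q| for q >= 0, with |log 0| = infinity *)
definition abs_log :: "real \<Rightarrow> ereal" where
  "abs_log q = (if q = 0 then \<infinity> else ereal \<bar>ln q\<bar>)"

(* log (t / s) for t >= s >= 0, with value 0 for t = s = 0 and infinity for t > s = 0 *)
definition log_ratio :: "real \<Rightarrow> real \<Rightarrow> ereal" where
  "log_ratio t s = (if s = 0 then (if t = 0 then 0 else \<infinity>) else ereal (ln (t / s)))"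

lemma coord_law_of_iid:
  fixes X :: "nat \<Rightarrow> 'a \<Rightarrow> real"
  assumes "prob_space M" and n: "1 \<le> n"
    and indep: "prob_space.indep_vars M (\<lambda>_. borel) X {1..n}"
    and law: "\<And>k. k \<in> {1..n} \<Longrightarrow> distr M borel (X k) = F"
  shows "coord_law F d n a j = distr M borel (\<lambda>\<omega>. (\<lambda>i\<in>{1..d}. \<Sum>k=1..n. X k \<omega> * a k i) j)"
proof -
  interpret prob_space M by fact
  have rv: "\<And>k. k \<in> {1..n} \<Longrightarrow> random_variable borel (X k)"
    using indep by (auto simp: indep_vars_def)
  have "distr M (Pi\<^sub>M {1..n} (\<lambda>_. borel)) (\<lambda>\<omega>. \<lambda>k\<in>{1..n}. X k \<omega>) = Pi\<^sub>M {1..n} (\<lambda>k. distr M borel (X k))"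
    using indep n by (subst indep_vars_iff_distr_eq_PiM'[symmetric]) (auto intro: rv)
  also have "\<dots> = Pi\<^sub>M {1..n} (\<lambda>_. F)"
    by (intro PiM_cong) (auto simp: law)
  finally have eq: "Pi\<^sub>M {1..n} (\<lambda>_. F) = distr M (Pi\<^sub>M {1..n} (\<lambda>_. borel)) (\<lambda>\<omega>. \<lambda>k\<in>{1..n}. X k \<omega>)" ..
  have m: "(\<lambda>\<omega>. \<lambda>k\<in>{1..n}. X k \<omega>) \<in> measurable M (Pi\<^sub>M {1..n} (\<lambda>_. borel))"
    using rv by measurable
  have ws: "(\<lambda>x. weighted_sum d n a x j) \<in> borel_measurable (Pi\<^sub>M {1..n} (\<lambda>_. borel))"
    by (cases "j \<in> {1..d}") (simp_all add: weighted_sum_def)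
  show ?thesis
    unfolding coord_law_def eq distr_distr[OF ws m]
    by (rule arg_cong[where f = "distr M borel"]) (auto simp: weighted_sum_def o_def fun_eq_iff)
qed

lemma diff_tail_of_indep:
  fixes X Y :: "'a \<Rightarrow> real"
  assumes "prob_space M" and indep: "prob_space.indep_var M borel X borel Y"
    and "distr M borel X = F" and "distr M borel Y = F"
  shows "diff_tail F t = measure M {\<omega> \<in> space M. \<bar>X \<omega> - Y \<omega>\<bar> > t}"
proof -
  interpret prob_space M by fact
  have XY[measurable]: "random_variable borel X" "random_variable borel Y"
    and eq: "F \<Otimes>\<^sub>M F = distr M (borel \<Otimes>\<^sub>M borel) (\<lambda>\<omega>. (X \<omega>, Y \<omega>))"
    using indep assms(3,4) by (auto simp: indep_var_distribution_eq)
  have "{(x, y). \<bar>x - y\<bar> > t} \<in> sets (borel \<Otimes>\<^sub>M borel :: (real \<times> real) measure)"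
  proof -
    have "{p \<in> space (borel \<Otimes>\<^sub>M borel :: (real \<times> real) measure). \<bar>fst p - snd p\<bar> > t}
        \<in> sets (borel \<Otimes>\<^sub>M borel)" by measurable
    then show ?thesis by (simp add: space_pair_measure case_prod_unfold)
  qed
  then show ?thesis
    unfolding diff_tail_def eq by (subst measure_distr) (auto intro!: arg_cong[where f = "measure M"])
qed

lemma K1_one_dim: "K1_real r u = (\<lambda>x. x 1) ` K1 1 r (\<lambda>j. \<lambda>i\<in>{1..1}. u j)"
  unfolding K1_real_def K1_def setcompr_eq_image image_image by (rule image_cong) auto

end

theory Submission
  imports Defs
begin

text \<open>
Fix one coordinate.  Choose coefficients greedily: as long as more than about \<open>r / p\<close> of the numbers \<open>a k\<close>,
where \<open>p = diff_tail F 1\<close>, are farther than \<open>\<delta>\<close> from the cube span of those already chosen, a further one of them can be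
examined, and with probability about \<open>p\<close> its summand is really random.  If so it is added to the chosen family.
Adding a number that is far from the cube span keeps the family dissociated (\<open>dissociated_insert\<close>): all its nontrivial sums with
coefficients \<open>-1, 0, 1\<close> exceed \<open>\<delta>\<close> in modulus.  Thus, if the greedy choice never stops, then outside
an event of probability exponentially small in \<open>r\<close> there is a dissociated family of \<open>r\<close> active coefficients.  Its \<open>2 ^ r\<close> random sign sums
are separated by \<open>\<delta>\<close>, and the concentration function at \<open>\<tau>\<close> is at most a power of \<open>\<tau> / \<delta>\<close> times
\<open>2 ^ (- r)\<close>.  For \<open>r\<close> a large multiple of \<open>\<bar>ln q\<bar> + ln (\<tau> / \<delta>) + 1\<close> this contradicts the value \<open>q\<close>.  Hence the
choice stops at a family of fewer than \<open>r\<close> coefficients whose cube span is \<open>\<delta>\<close>-close to all but about \<open>r / p\<close> of the \<open>a k\<close>.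

The law of the summands is arbitrary, and a separate random factor for every coefficient would destroy
dissociation.  The reduction to lazy random signs therefore uses characteristic functions.  Esseen's
inequality with a Gaussian weight (\<open>conc_fun_le_gauss\<close>) bounds the concentration function by an average of
the product of the moduli of the characteristic functions, symmetrisation expresses these through
\<open>cos (a k * t * y)\<close>, where \<open>y\<close> is the difference of two independent copies, and Jensen's inequality (\<open>prod_norm_char_le\<close>) lets one
common \<open>y\<close> with \<open>\<bar>y\<bar> > 1\<close> act on all coefficients.  Such a \<open>y\<close> only enlarges distances.  The greedy argument
is then an induction on Gaussian averages of products of cosines (\<open>exposure_bound\<close>).

In dimension \<open>d\<close> the coordinates are treated separately, and a union bound over the coordinates together with
concatenation of the generators gives the theorem.
\<close>

section \<open>Gaussian averages of products of cosines\<close>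

abbreviation gauss :: "real measure" where "gauss \<equiv> std_normal_distribution"

interpretation gauss: real_distribution gauss by (rule real_dist_normal_dist)

lemma integrable_gauss:
  fixes f :: "real \<Rightarrow> real"
  assumes "f \<in> borel_measurable borel" "\<And>t. \<bar>f t\<bar> \<le> B"
  shows "integrable gauss f"
  using assms by (intro gauss.integrable_const_bound[where B = B]) auto

text \<open>The characteristic function of a lazy symmetric step: \<open>\<plusminus>1\<close> with probability \<open>\<theta>/2\<close> each, and no step with
probability \<open>1 - \<theta>\<close>.  As a mixture of \<open>1\<close> and \<open>cos\<close> it allows the steps to be revealed one by one.\<close>

definition lazy_cos :: "real \<Rightarrow> real \<Rightarrow> real" where
  "lazy_cos \<theta> x = 1 - \<theta> + \<theta> * cos x"

lemma lazy_cos_measurable [measurable]: "lazy_cos \<theta> \<in> borel_measurable borel"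
  unfolding lazy_cos_def by measurable

lemma lazy_cos_bounds:
  assumes "0 \<le> \<theta>" "\<theta> \<le> 1/2"
  shows "0 \<le> lazy_cos \<theta> x" "lazy_cos \<theta> x \<le> 1"
proof -
  have "\<theta> * cos x \<le> \<theta> * 1" "\<theta> * (-1) \<le> \<theta> * cos x"
    using assms by (intro mult_left_mono; simp)+
  with assms show "0 \<le> lazy_cos \<theta> x" "lazy_cos \<theta> x \<le> 1"
    unfolding lazy_cos_def by linarith+
qed

lemma abs_prod_cos_le_one: "\<bar>\<Prod>j\<in>J. cos (b j)\<bar> \<le> (1::real)"
  unfolding abs_prod by (rule prod_le_1) auto

lemma abs_prod_lazy_cos_le_one:
  assumes "0 \<le> \<theta>" "\<theta> \<le> 1/2"
  shows "\<bar>\<Prod>j\<in>J. lazy_cos \<theta> (b j)\<bar> \<le> 1"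
  unfolding abs_prod using lazy_cos_bounds[OF assms] by (intro prod_le_1) auto

lemma gauss_cos: "(\<integral>t. cos (x * t) \<partial>gauss) = exp (- x\<^sup>2 / 2)"
proof -
  have "char gauss x = of_real (exp (- x\<^sup>2 / 2))" by (simp add: char_std_normal_distribution)
  then have "Re (char gauss x) = exp (- x\<^sup>2 / 2)" by simp
  moreover have "Re (char gauss x) = (\<integral>t. cos (x * t) \<partial>gauss)"
  proof -
    have "integrable gauss (\<lambda>t. iexp (x * t))" by (rule gauss.integrable_iexp) auto
    then show ?thesis unfolding char_def by (subst integral_Re[symmetric]) (auto simp: Re_exp)
  qed
  ultimately show ?thesis by simp
qed

definition signed_sum :: "('i \<Rightarrow> real) \<Rightarrow> 'i set \<Rightarrow> 'i set \<Rightarrow> real" where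
  "signed_sum b J P = (\<Sum>j\<in>J. (if j \<in> P then 1 else - 1) * b j)"

text \<open>A product of cosines is the characteristic function of a Rademacher sum, so its Gaussian average is
the average of the Gaussian kernel over the atoms of that sum.\<close>

lemma gauss_prod_cos:
  assumes "finite J"
  shows "(\<integral>t. cos (x * t) * (\<Prod>j\<in>J. cos (b j * t)) \<partial>gauss)
       = (1/2) ^ card J * (\<Sum>P\<in>Pow J. exp (- (x + signed_sum b J P)\<^sup>2 / 2))"
  using assms
proof (induction J arbitrary: x)
  case empty
  then show ?case by (simp add: gauss_cos signed_sum_def)
next
  case (insert i J)
  let ?g = "\<lambda>y t. cos (y * t) * (\<Prod>j\<in>J. cos (b j * t))"
  let ?S = "\<lambda>y. \<Sum>P\<in>Pow J. exp (- (y + signed_sum b J P)\<^sup>2 / 2)"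
  have int: "integrable gauss (?g y)" for y
    by (rule integrable_gauss[where B = 1])
      (auto simp: abs_mult intro!: mult_le_one abs_prod_cos_le_one)
  have "cos (x * t) * (\<Prod>j\<in>insert i J. cos (b j * t)) = (?g (x + b i) t + ?g (x - b i) t) / 2" for t
    using insert(1,2) by (simp add: algebra_simps cos_add cos_diff)
  then have "(\<integral>t. cos (x * t) * (\<Prod>j\<in>insert i J. cos (b j * t)) \<partial>gauss)
     = (\<integral>t. (?g (x + b i) t + ?g (x - b i) t) / 2 \<partial>gauss)" by (simp only:)
  also have "\<dots> = ((\<integral>t. ?g (x + b i) t \<partial>gauss) + (\<integral>t. ?g (x - b i) t \<partial>gauss)) / 2"
    unfolding integral_divide_zero Bochner_Integration.integral_add[OF int int] ..
  also have "\<dots> = (1/2) ^ card (insert i J) * (?S (x + b i) + ?S (x - b i))"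
    using insert(1,2) unfolding insert.IH by (simp add: field_simps)
  also have "?S (x + b i) + ?S (x - b i)
     = (\<Sum>P\<in>Pow (insert i J). exp (- (x + signed_sum b (insert i J) P)\<^sup>2 / 2))"
  proof -
    have inj: "inj_on (insert i) (Pow J)" using insert(2) by (auto simp: inj_on_def)
    have "i \<notin> P" if "P \<in> Pow J" for P using that insert(2) by auto
    then have 1: "signed_sum b (insert i J) P = signed_sum b J P - b i" if "P \<in> Pow J" for P
      using insert(1,2) that by (simp add: signed_sum_def)
    have 2: "signed_sum b (insert i J) (insert i P) = signed_sum b J P + b i" for P
    proof -
      have "(\<Sum>j\<in>J. (if j \<in> insert i P then 1 else - 1) * b j) = (\<Sum>j\<in>J. (if j \<in> P then 1 else - 1) * b j)"
        using insert(2) by (intro sum.cong) auto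
      then show ?thesis using insert(1,2) by (simp add: signed_sum_def)
    qed
    have "(\<Sum>P\<in>Pow (insert i J). exp (- (x + signed_sum b (insert i J) P)\<^sup>2 / 2))
      = (\<Sum>P\<in>Pow J. exp (- (x + signed_sum b (insert i J) P)\<^sup>2 / 2))
       + (\<Sum>P\<in>insert i ` Pow J. exp (- (x + signed_sum b (insert i J) P)\<^sup>2 / 2))"
      unfolding Pow_insert using insert by (intro sum.union_disjoint) auto
    also have "(\<Sum>P\<in>insert i ` Pow J. exp (- (x + signed_sum b (insert i J) P)\<^sup>2 / 2)) = ?S (x + b i)"
      by (subst sum.reindex[OF inj]) (simp add: 2 algebra_simps)
    also have "(\<Sum>P\<in>Pow J. exp (- (x + signed_sum b (insert i J) P)\<^sup>2 / 2)) = ?S (x - b i)"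
      by (intro sum.cong) (simp_all add: 1 algebra_simps)
    finally show ?thesis by simp
  qed
  finally show ?case .
qed

lemma sum_inverse_squares_le:
  assumes "finite K"
  shows "(\<Sum>k\<in>K. 1 / (1 + (real k)\<^sup>2)) \<le> 4"
proof -
  have tele: "(\<Sum>k<m. 1 / (1 + (real k)\<^sup>2)) \<le> 4 - 4 / (real m + 1)" for m
  proof (induction m)
    case (Suc m)
    have *: "0 \<le> 3 * (real m)\<^sup>2 - 3 * real m + 2"
    proof -
      have "0 \<le> 3 * (real m - 1/2)\<^sup>2" by simp
      then show ?thesis by (simp add: power2_eq_square algebra_simps)
    qed
    have "1 / (1 + (real m)\<^sup>2) = 4 / (4 * (1 + (real m)\<^sup>2))" by (metis mult.right_neutral mult_divide_mult_cancel_left zero_neq_numeral)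
    also have "\<dots> \<le> 4 / ((real m + 1) * (real m + 2))"
    proof (rule divide_left_mono)
      show "(real m + 1) * (real m + 2) \<le> 4 * (1 + (real m)\<^sup>2)"
        using * by (simp add: power2_eq_square algebra_simps)
      have "0 < 1 + (real m)\<^sup>2" by (simp add: add_pos_nonneg)
      moreover have "0 < real m + 1" "0 < real m + 2" by linarith+
      ultimately show "0 < 4 * (1 + (real m)\<^sup>2) * ((real m + 1) * (real m + 2))"
        by (intro mult_pos_pos) auto
    qed simp
    also have "\<dots> = 4 / (real m + 1) - 4 / (real (Suc m) + 1)"
      by (simp add: divide_simps)
    finally show ?case using Suc by simp
  qed simp
  obtain m where "K \<subseteq> {..<m}" using finite_nat_iff_bounded[THEN iffD1, OF assms] by auto
  then have "(\<Sum>k\<in>K. 1 / (1 + (real k)\<^sup>2)) \<le> (\<Sum>k<m. 1 / (1 + (real k)\<^sup>2))"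
    by (intro sum_mono2) (auto intro!: divide_nonneg_nonneg add_nonneg_nonneg)
  also have "\<dots> \<le> 4" by (rule order_trans[OF tele]) simp
  finally show ?thesis .
qed

text \<open>Points of one sign that are more than \<open>\<epsilon>\<close> apart have different values of \<open>\<lfloor>\<bar>y\<bar> / \<epsilon>\<rfloor>\<close>, and
\<open>exp (- y\<^sup>2 / 2)\<close> is at most \<open>(2 / \<epsilon>\<^sup>2) / (1 + k\<^sup>2)\<close> when this value is \<open>k\<close>.  The true order is
\<open>1 / \<epsilon>\<close>; as only the logarithm of the bound is used later, the square is harmless.\<close>

lemma sum_gauss_kernel_separated_le:
  fixes y :: "'b \<Rightarrow> real"
  assumes fin: "finite I" and \<epsilon>: "0 < \<epsilon>" "\<epsilon> \<le> 1"
    and sep: "\<And>P P'. P \<in> I \<Longrightarrow> P' \<in> I \<Longrightarrow> P \<noteq> P' \<Longrightarrow> \<epsilon> < \<bar>y P - y P'\<bar>"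
  shows "(\<Sum>P\<in>I. exp (- (y P)\<^sup>2 / 2)) \<le> 16 / \<epsilon>\<^sup>2"
proof -
  define h where "h P = \<lfloor>\<bar>y P\<bar> / \<epsilon>\<rfloor>" for P
  have hle: "real (nat (h P)) \<le> \<bar>y P\<bar> / \<epsilon>" for P
    using \<epsilon> unfolding h_def by simp
  have summand: "exp (- (y P)\<^sup>2 / 2) \<le> 2 / \<epsilon>\<^sup>2 * (1 / (1 + (real (nat (h P)))\<^sup>2))" for P
  proof -
    let ?k = "real (nat (h P))"
    have "?k * \<epsilon> \<le> \<bar>y P\<bar>" using hle[of P] \<epsilon> by (simp add: field_simps)
    then have "(?k * \<epsilon>)\<^sup>2 \<le> (y P)\<^sup>2" using \<epsilon> by (metis abs_le_square_iff abs_of_nonneg mult_nonneg_nonneg of_nat_0_le_iff less_imp_le abs_abs)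
    moreover have "\<epsilon>\<^sup>2 \<le> 1" using \<epsilon> by (simp add: power_le_one)
    ultimately have "\<epsilon>\<^sup>2 * (1 + ?k\<^sup>2) / 2 \<le> 1 + (y P)\<^sup>2 / 2" by (simp add: power_mult_distrib algebra_simps)
    also have "\<dots> \<le> exp ((y P)\<^sup>2 / 2)" by (rule exp_ge_add_one_self)
    finally have "\<epsilon>\<^sup>2 * (1 + ?k\<^sup>2) / 2 \<le> exp ((y P)\<^sup>2 / 2)" .
    moreover have "0 < \<epsilon>\<^sup>2 * (1 + ?k\<^sup>2) / 2" using \<epsilon> by (auto intro!: mult_pos_pos add_pos_nonneg)
    ultimately have "inverse (exp ((y P)\<^sup>2 / 2)) \<le> inverse (\<epsilon>\<^sup>2 * (1 + ?k\<^sup>2) / 2)"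
      by (rule le_imp_inverse_le)
    then show ?thesis by (simp add: exp_minus inverse_eq_divide)
  qed
  have half: "(\<Sum>P\<in>I'. exp (- (y P)\<^sup>2 / 2)) \<le> 8 / \<epsilon>\<^sup>2"
    if I': "I' \<subseteq> I" and same: "\<And>P P'. P \<in> I' \<Longrightarrow> P' \<in> I' \<Longrightarrow> \<bar>y P - y P'\<bar> = \<bar>\<bar>y P\<bar> - \<bar>y P'\<bar>\<bar>" for I'
  proof -
    have inj: "inj_on (\<lambda>P. nat (h P)) I'"
    proof (rule inj_onI, rule ccontr)
      fix P P' assume P: "P \<in> I'" "P' \<in> I'" "nat (h P) = nat (h P')" "P \<noteq> P'"
      have "h P = h P'" using P(3) \<epsilon> unfolding h_def by (simp add: eq_nat_nat_iff)
      then have "\<bar>\<bar>y P\<bar> / \<epsilon> - \<bar>y P'\<bar> / \<epsilon>\<bar> < 1" unfolding h_def by linarith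
      then have "\<bar>\<bar>y P\<bar> - \<bar>y P'\<bar>\<bar> < \<epsilon>" using \<epsilon> by (simp add: diff_divide_distrib[symmetric] abs_divide)
      then show False using sep[of P P'] same[OF P(1,2)] P I' by auto
    qed
    have "(\<Sum>P\<in>I'. exp (- (y P)\<^sup>2 / 2)) \<le> (\<Sum>P\<in>I'. 2 / \<epsilon>\<^sup>2 * (1 / (1 + (real (nat (h P)))\<^sup>2)))"
      by (rule sum_mono) (rule summand)
    also have "\<dots> = 2 / \<epsilon>\<^sup>2 * (\<Sum>k\<in>(\<lambda>P. nat (h P)) ` I'. 1 / (1 + (real k)\<^sup>2))"
      by (subst sum.reindex[OF inj]) (simp add: sum_distrib_left)
    also have "\<dots> \<le> 2 / \<epsilon>\<^sup>2 * 4"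
      using finite_subset[OF I' fin] by (intro mult_left_mono sum_inverse_squares_le) auto
    finally show ?thesis by simp
  qed
  have "I = {P\<in>I. 0 \<le> y P} \<union> {P\<in>I. y P < 0}" by auto
  then have "(\<Sum>P\<in>I. exp (- (y P)\<^sup>2 / 2))
     = (\<Sum>P\<in>{P\<in>I. 0 \<le> y P}. exp (- (y P)\<^sup>2 / 2)) + (\<Sum>P\<in>{P\<in>I. y P < 0}. exp (- (y P)\<^sup>2 / 2))"
    using fin by (subst sum.union_disjoint[symmetric]) auto
  also have "\<dots> \<le> 8 / \<epsilon>\<^sup>2 + 8 / \<epsilon>\<^sup>2" by (intro add_mono half) auto
  finally show ?thesis by simp
qed

section \<open>Dissociated families\<close>

text \<open>All nontrivial sums with coefficients in \<open>{-1, 0, 1}\<close> stay away from \<open>0\<close>; for \<open>\<delta> = 0\<close> these are the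
dissociated sets of harmonic analysis.  Two different Rademacher sums over such a set differ by
more than \<open>2 * \<delta>\<close>.\<close>

definition dissociated :: "real \<Rightarrow> ('i \<Rightarrow> real) \<Rightarrow> 'i set \<Rightarrow> bool" where
  "dissociated \<delta> a J \<longleftrightarrow>
     (\<forall>m\<in>J \<rightarrow> {-1, 0, 1 :: int}. (\<exists>j\<in>J. m j \<noteq> 0) \<longrightarrow> \<delta> < \<bar>\<Sum>j\<in>J. real_of_int (m j) * a j\<bar>)"

definition cube_span :: "('i \<Rightarrow> real) \<Rightarrow> 'i set \<Rightarrow> real set" where
  "cube_span a J = {\<Sum>j\<in>J. real_of_int (m j) * a j | m. m \<in> J \<rightarrow> {-1, 0, 1 :: int}}"

lemma dissociated_scale:
  assumes "dissociated \<delta> a J" "\<epsilon> \<le> \<bar>s\<bar> * \<delta>" "s \<noteq> 0"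
  shows "dissociated \<epsilon> (\<lambda>k. s * a k) J"
  unfolding dissociated_def
proof (intro ballI impI)
  fix m :: "'a \<Rightarrow> int" assume m: "m \<in> J \<rightarrow> {-1, 0, 1}" "\<exists>j\<in>J. m j \<noteq> 0"
  have "\<epsilon> \<le> \<bar>s\<bar> * \<delta>" by fact
  also have "\<dots> < \<bar>s\<bar> * \<bar>\<Sum>j\<in>J. real_of_int (m j) * a j\<bar>"
    using assms(1,3) m by (auto simp: dissociated_def)
  also have "\<dots> = \<bar>\<Sum>j\<in>J. real_of_int (m j) * (s * a j)\<bar>"
    by (simp add: abs_mult[symmetric] sum_distrib_left mult.left_commute)
  finally show "\<epsilon> < \<bar>\<Sum>j\<in>J. real_of_int (m j) * (s * a j)\<bar>" .
qed

text \<open>The reason why cube spans appear in the theorem: an element far from the cube span of a dissociated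
family extends the family, so a maximal dissociated family has everything close to its cube span.\<close>

lemma dissociated_insert:
  assumes J: "finite J" "dissociated \<delta> a J"
    and far: "\<And>z. z \<in> cube_span a J \<Longrightarrow> \<delta> < \<bar>a i - z\<bar>" and "i \<notin> J"
  shows "dissociated \<delta> a (insert i J)"
  unfolding dissociated_def
proof (intro ballI impI)
  fix m :: "'a \<Rightarrow> int" assume m: "m \<in> insert i J \<rightarrow> {-1, 0, 1}" "\<exists>j\<in>insert i J. m j \<noteq> 0"
  have sum: "(\<Sum>j\<in>insert i J. real_of_int (m j) * a j) = m i * a i + (\<Sum>j\<in>J. m j * a j)"
    using J \<open>i \<notin> J\<close> by simp
  have mi: "m i = 0 \<or> m i = 1 \<or> m i = -1" using m by auto
  show "\<delta> < \<bar>\<Sum>j\<in>insert i J. real_of_int (m j) * a j\<bar>"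
  proof (cases "m i = 0")
    case True
    then have "m \<in> J \<rightarrow> {-1, 0, 1}" "\<exists>j\<in>J. m j \<noteq> 0" using m by auto
    then show ?thesis using J(2) True unfolding sum dissociated_def by simp
  next
    case False
    \<comment> \<open>Multiplying by the sign of the new coefficient moves the relation to the form a i - z.\<close>
    let ?z = "\<Sum>j\<in>J. real_of_int (- (m i * m j)) * a j"
    have "?z \<in> cube_span a J"
      unfolding cube_span_def using m mi by (auto intro!: exI[of _ "\<lambda>j. - (m i * m j)"])
    then have "\<delta> < \<bar>a i - ?z\<bar>" by (rule far)
    also have "a i - ?z = real_of_int (m i) * (m i * a i + (\<Sum>j\<in>J. m j * a j))"
      using mi False by (auto simp: sum_distrib_left sum_negf algebra_simps)
    also have "\<bar>\<dots>\<bar> = \<bar>m i * a i + (\<Sum>j\<in>J. m j * a j)\<bar>"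
      using mi False by (auto simp: abs_mult)
    finally show ?thesis unfolding sum .
  qed
qed

lemma dissociated_gauss_bound:
  assumes J: "finite J" "dissociated \<epsilon> b J" and \<epsilon>: "0 < \<epsilon>" "\<epsilon> \<le> 1"
  shows "\<bar>\<integral>t. cos (x * t) * (\<Prod>j\<in>J. cos (b j * t)) \<partial>gauss\<bar> \<le> (1/2) ^ card J * (16 / \<epsilon>\<^sup>2)"
proof -
  have "(\<Sum>P\<in>Pow J. exp (- (x + signed_sum b J P)\<^sup>2 / 2)) \<le> 16 / \<epsilon>\<^sup>2"
  proof (rule sum_gauss_kernel_separated_le[OF _ \<epsilon>], goal_cases)
    case (2 P P')
    note P = this
    define m :: "'a \<Rightarrow> int" where "m j = of_bool (j \<in> P) - of_bool (j \<in> P')" for j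
    have "m \<in> J \<rightarrow> {-1, 0, 1}" by (auto simp: m_def)
    moreover have "\<exists>j\<in>J. m j \<noteq> 0"
    proof -
      obtain j where "j \<in> P - P' \<or> j \<in> P' - P" using P(3) by auto
      then show ?thesis using P(1,2) by (intro bexI[of _ j]) (auto simp: m_def)
    qed
    ultimately have "\<epsilon> < \<bar>\<Sum>j\<in>J. real_of_int (m j) * b j\<bar>"
      using J(2) by (simp add: dissociated_def)
    moreover have "signed_sum b J P - signed_sum b J P' = 2 * (\<Sum>j\<in>J. real_of_int (m j) * b j)"
      unfolding signed_sum_def sum_subtractf[symmetric] sum_distrib_left
      by (intro sum.cong) (auto simp: m_def)
    ultimately show ?case by simp
  qed (use J in auto)
  moreover have "0 \<le> (\<Sum>P\<in>Pow J. exp (- (x + signed_sum b J P)\<^sup>2 / 2))" by (intro sum_nonneg) auto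
  ultimately show ?thesis unfolding gauss_prod_cos[OF J(1)] unfolding abs_mult
    by (intro mult_mono) auto
qed

text \<open>Further independent steps only shift the Rademacher sum at random, which cannot increase the
supremum over \<open>x\<close>.\<close>

lemma dissociated_lazy_gauss_bound:
  assumes S: "finite S" and J: "finite J" "dissociated \<epsilon> b J" and \<epsilon>: "0 < \<epsilon>" "\<epsilon> \<le> 1"
    and \<theta>: "0 \<le> \<theta>" "\<theta> \<le> 1/2"
  shows "\<bar>\<integral>t. cos (x * t) * (\<Prod>k\<in>S. lazy_cos \<theta> (b k * t)) * (\<Prod>j\<in>J. cos (b j * t)) \<partial>gauss\<bar>
    \<le> (1/2) ^ card J * (16 / \<epsilon>\<^sup>2)"
  using S
proof (induction S arbitrary: x)
  case empty
  then show ?case using dissociated_gauss_bound[OF J \<epsilon>] by simp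
next
  case (insert i S)
  let ?g = "\<lambda>y t. cos (y * t) * (\<Prod>k\<in>S. lazy_cos \<theta> (b k * t)) * (\<Prod>j\<in>J. cos (b j * t))"
  let ?B = "(1/2) ^ card J * (16 / \<epsilon>\<^sup>2)"
  have int: "integrable gauss (?g y)" for y
    by (rule integrable_gauss[where B = 1])
      (auto simp: abs_mult intro!: mult_le_one abs_prod_cos_le_one abs_prod_lazy_cos_le_one[OF \<theta>])
  have *: "cos (x * t) * lazy_cos \<theta> (b i * t)
    = (1 - \<theta>) * cos (x * t) + \<theta> / 2 * cos ((x + b i) * t) + \<theta> / 2 * cos ((x - b i) * t)" for t
    by (simp add: lazy_cos_def cos_add cos_diff algebra_simps)
  have "cos (x * t) * (\<Prod>k\<in>insert i S. lazy_cos \<theta> (b k * t)) * (\<Prod>j\<in>J. cos (b j * t))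
    = (cos (x * t) * lazy_cos \<theta> (b i * t)) * ((\<Prod>k\<in>S. lazy_cos \<theta> (b k * t)) * (\<Prod>j\<in>J. cos (b j * t)))" for t
    using insert by (simp add: mult_ac)
  also have "\<dots> t = (1 - \<theta>) * ?g x t + \<theta> / 2 * ?g (x + b i) t + \<theta> / 2 * ?g (x - b i) t" for t
    unfolding * by (simp add: algebra_simps)
  finally have eq: "cos (x * t) * (\<Prod>k\<in>insert i S. lazy_cos \<theta> (b k * t)) * (\<Prod>j\<in>J. cos (b j * t))
    = (1 - \<theta>) * ?g x t + \<theta> / 2 * ?g (x + b i) t + \<theta> / 2 * ?g (x - b i) t" for t .
  define I where "I y = (\<integral>t. ?g y t \<partial>gauss)" for y
  have I: "\<bar>I y\<bar> \<le> ?B" for y unfolding I_def by (rule insert.IH)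
  have split: "(\<integral>t. cos (x * t) * (\<Prod>k\<in>insert i S. lazy_cos \<theta> (b k * t)) * (\<Prod>j\<in>J. cos (b j * t)) \<partial>gauss)
    = (1 - \<theta>) * I x + \<theta> / 2 * I (x + b i) + \<theta> / 2 * I (x - b i)"
    unfolding eq I_def using int by simp
  have "\<bar>(1 - \<theta>) * I x + \<theta> / 2 * I (x + b i) + \<theta> / 2 * I (x - b i)\<bar>
     \<le> \<bar>(1 - \<theta>) * I x\<bar> + \<bar>\<theta> / 2 * I (x + b i)\<bar> + \<bar>\<theta> / 2 * I (x - b i)\<bar>"
    by linarith
  also have "\<dots> \<le> (1 - \<theta>) * ?B + \<theta> / 2 * ?B + \<theta> / 2 * ?B"
    unfolding abs_mult using \<theta> by (intro add_mono mult_mono I) auto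
  also have "\<dots> = ?B"
  proof -
    have "(1 - \<theta>) * B + \<theta> / 2 * B + \<theta> / 2 * B = B" for B :: real by (simp add: algebra_simps)
    then show ?thesis .
  qed
  finally show ?case unfolding split .
qed

section \<open>Revealing the coefficients one by one\<close>

text \<open>The heart of the proof.  The factors over \<open>S\<close> belong to coefficients not yet revealed, those over \<open>J\<close>
to revealed coefficients that made a step.  As long as \<open>J\<close> has fewer than \<open>r\<close> elements, some
unrevealed coefficient is far from the cube span of \<open>J\<close>.  It is revealed next: with
probability \<open>\<theta>\<close> it joins \<open>J\<close>, which remains dissociated, and with probability \<open>1 - \<theta>\<close> it is dropped.
Once \<open>J\<close> has \<open>r\<close> elements the \<open>2 ^ r\<close> separated atoms give the first term.  The second
term is the exponential Markov bound for having fewer than \<open>r\<close> successes in the allowed number of trials: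
each missing success costs a factor \<open>2\<close>, and \<open>(1 - \<theta>) + \<theta> / 2 = 1 - \<theta> / 2\<close> is the factor per trial.

Dissociation is measured for \<open>a\<close> at scale \<open>\<delta>\<close>, but the steps are those of \<open>s * a\<close>; the choice of \<open>J\<close> thus does
not depend on \<open>s\<close>.\<close>

lemma exposure_bound:
  fixes a :: "'i \<Rightarrow> real"
  assumes A: "finite A" and \<epsilon>: "0 < \<epsilon>" "\<epsilon> \<le> 1" "\<epsilon> \<le> \<bar>s\<bar> * \<delta>" and \<theta>: "0 \<le> \<theta>" "\<theta> \<le> 1/2"
    and many: "\<And>J. J \<subseteq> A \<Longrightarrow> dissociated \<delta> a J \<Longrightarrow> card J < r \<Longrightarrow>
        N \<le> card {k\<in>A. \<forall>z\<in>cube_span a J. \<delta> < \<bar>a k - z\<bar>}"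
    and "S \<subseteq> A" "J \<subseteq> A - S" "dissociated \<delta> a J" "card J \<le> r" "m + card (A - S) \<le> N"
  shows "(\<integral>t. (\<Prod>k\<in>S. lazy_cos \<theta> (s * a k * t)) * (\<Prod>j\<in>J. cos (s * a j * t)) \<partial>gauss)
    \<le> (1/2) ^ r * (16 / \<epsilon>\<^sup>2) + 2 ^ (r - card J) * (1 - \<theta> / 2) ^ m"
  using assms(8-12)
proof (induction m arbitrary: S J)
  case (0 S J)
  let ?f = "\<lambda>t. (\<Prod>k\<in>S. lazy_cos \<theta> (s * a k * t)) * (\<Prod>j\<in>J. cos (s * a j * t))"
  have b: "\<bar>?f t\<bar> \<le> 1" for t
    by (auto simp: abs_mult intro!: mult_le_one abs_prod_cos_le_one abs_prod_lazy_cos_le_one[OF \<theta>])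
  have "(\<integral>t. ?f t \<partial>gauss) \<le> (\<integral>t. 1 \<partial>gauss)"
    using b by (intro integral_mono integrable_gauss[where B = 1]) (auto simp: abs_le_iff)
  also have "\<dots> = 1" using gauss.prob_space by simp
  also have "\<dots> \<le> 2 ^ (r - card J)" by simp
  also have "\<dots> \<le> (1/2) ^ r * (16 / \<epsilon>\<^sup>2) + 2 ^ (r - card J)" by simp
  finally show ?case by simp
next
  case (Suc m S J)
  have fin: "finite S" "finite J" using Suc.prems A by (auto intro: finite_subset)
  show ?case
  proof (cases "card J = r")
    case True
    have "s \<noteq> 0" using \<epsilon> by auto
    then have "dissociated \<epsilon> (\<lambda>k. s * a k) J"
      using Suc.prems \<epsilon> by (intro dissociated_scale) auto
    from dissociated_lazy_gauss_bound[OF fin this \<epsilon>(1,2) \<theta>, of 0]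
    have "(\<integral>t. (\<Prod>k\<in>S. lazy_cos \<theta> (s * a k * t)) * (\<Prod>j\<in>J. cos (s * a j * t)) \<partial>gauss)
        \<le> (1/2) ^ r * (16 / \<epsilon>\<^sup>2)" using True by simp
    moreover have "0 \<le> 2 ^ (r - card J) * (1 - \<theta> / 2) ^ Suc m" using \<theta> by simp
    ultimately show ?thesis by linarith
  next
    case False
    then have lt: "card J < r" using Suc.prems by simp
    let ?far = "{k\<in>A. \<forall>z\<in>cube_span a J. \<delta> < \<bar>a k - z\<bar>}"
    \<comment> \<open>Fewer than N indices have left S, so some far index is still in S.\<close>
    have "\<not> ?far \<subseteq> A - S"
    proof
      assume "?far \<subseteq> A - S"
      then have "card ?far \<le> card (A - S)" using A by (intro card_mono) auto
      moreover have "N \<le> card ?far" using Suc.prems lt by (intro many) auto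
      ultimately show False using Suc.prems by simp
    qed
    then obtain i where i: "i \<in> S" "\<And>z. z \<in> cube_span a J \<Longrightarrow> \<delta> < \<bar>a i - z\<bar>" by auto
    let ?S = "S - {i}" and ?J = "insert i J"
    have iJ: "i \<notin> J" using Suc.prems i by auto
    have dis: "dissociated \<delta> a ?J" using fin Suc.prems i iJ by (intro dissociated_insert) auto
    have AS: "A - ?S = insert i (A - S)" using i Suc.prems by auto
    have card: "m + card (A - ?S) \<le> N" unfolding AS using A Suc.prems i by simp
    let ?p = "\<lambda>t. \<Prod>k\<in>?S. lazy_cos \<theta> (s * a k * t)"
    let ?c = "\<lambda>J t. \<Prod>j\<in>J. cos (s * a j * t)"
    have int: "integrable gauss (\<lambda>t. ?p t * ?c J' t)" for J'
      by (rule integrable_gauss[where B = 1])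
        (auto simp: abs_mult intro!: mult_le_one abs_prod_cos_le_one abs_prod_lazy_cos_le_one[OF \<theta>])
    let ?B = "(1/2) ^ r * (16 / \<epsilon>\<^sup>2)"
    have r: "r - card J = Suc (r - Suc (card J))" using lt by simp
    have "(\<Prod>k\<in>S. lazy_cos \<theta> (s * a k * t)) * ?c J t
        = (1 - \<theta>) * (?p t * ?c J t) + \<theta> * (?p t * ?c ?J t)" for t
      unfolding prod.remove[OF fin(1) i(1)] using fin iJ by (simp add: lazy_cos_def algebra_simps)
    then have "(\<integral>t. (\<Prod>k\<in>S. lazy_cos \<theta> (s * a k * t)) * ?c J t \<partial>gauss)
        = (1 - \<theta>) * (\<integral>t. ?p t * ?c J t \<partial>gauss) + \<theta> * (\<integral>t. ?p t * ?c ?J t \<partial>gauss)"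
      using int by simp
    also have "\<dots> \<le> (1 - \<theta>) * (?B + 2 ^ (r - card J) * (1 - \<theta> / 2) ^ m)
        + \<theta> * (?B + 2 ^ (r - card ?J) * (1 - \<theta> / 2) ^ m)"
      using \<theta> Suc.prems dis card lt fin iJ i
      by (intro add_mono mult_left_mono Suc.IH) auto
    also have "\<dots> = ?B + 2 ^ (r - card J) * (1 - \<theta> / 2) ^ Suc m"
    proof -
      have "(1 - \<theta>) * (B + 2 * y * z) + \<theta> * (B + y * z) = B + 2 * y * ((1 - \<theta> / 2) * z)" for B y z :: real
        by (simp add: algebra_simps)
      then show ?thesis using fin iJ by (simp only: r power_Suc card_insert_disjoint not_False_eq_True)
    qed
    finally show ?thesis .
  qed
qed

lemma lazy_product_bound:
  fixes a :: "'i \<Rightarrow> real"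
  assumes A: "finite A" and \<epsilon>: "0 < \<epsilon>" "\<epsilon> \<le> 1" "\<epsilon> \<le> \<bar>s\<bar> * \<delta>" and \<theta>: "0 \<le> \<theta>" "\<theta> \<le> 1/2"
    and many: "\<And>J. J \<subseteq> A \<Longrightarrow> dissociated \<delta> a J \<Longrightarrow> card J < r \<Longrightarrow>
        N \<le> card {k\<in>A. \<forall>z\<in>cube_span a J. \<delta> < \<bar>a k - z\<bar>}"
  shows "(\<integral>t. (\<Prod>k\<in>A. lazy_cos \<theta> (s * a k * t)) \<partial>gauss)
    \<le> (1/2) ^ r * (16 / \<epsilon>\<^sup>2) + 2 ^ r * (1 - \<theta> / 2) ^ N"
proof -
  have "dissociated \<delta> a {}" by (simp add: dissociated_def)
  then show ?thesis
    using exposure_bound[OF A \<epsilon> \<theta>, where a = a and r = r and N = N and S = A and J = "{}" and m = N] many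
    by simp
qed

section \<open>From the concentration function to lazy steps\<close>

text \<open>Esseen's inequality with a Gaussian weight: on an interval of length \<open>\<tau>\<close> around \<open>x\<close> the kernel
\<open>exp (- ((y - x) / \<tau>)\<^sup>2 / 2)\<close> is at least \<open>1/2\<close>, and its mean is a Gaussian average of the
characteristic function.\<close>

lemma conc_fun_le_gauss:
  assumes "real_distribution M" and \<tau>: "0 < \<tau>"
  shows "conc_fun M \<tau> \<le> 2 * (\<integral>t. norm (char M (t / \<tau>)) \<partial>gauss)"
  unfolding conc_fun_def
proof (rule cSUP_least)
  fix x :: real
  interpret M: real_distribution M by fact
  interpret P: pair_prob_space M gauss ..
  have int: "integrable (M \<Otimes>\<^sub>M gauss) (\<lambda>(y, t). cos ((y - x) / \<tau> * t))"
    by (rule P.integrable_const_bound[where B = 1]) auto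
  have "measure M {x - \<tau> / 2 .. x + \<tau> / 2} = (\<integral>y. indicator {x - \<tau> / 2 .. x + \<tau> / 2} y \<partial>M)" by simp
  also have "\<dots> \<le> (\<integral>y. 2 * exp (- ((y - x) / \<tau>)\<^sup>2 / 2) \<partial>M)"
  proof (rule integral_mono)
    show "integrable M (\<lambda>y. 2 * exp (- ((y - x) / \<tau>)\<^sup>2 / 2))"
      by (rule M.integrable_const_bound[where B = 2]) auto
    show "indicator {x - \<tau> / 2 .. x + \<tau> / 2} y \<le> 2 * exp (- ((y - x) / \<tau>)\<^sup>2 / 2)" for y
    proof (cases "y \<in> {x - \<tau> / 2 .. x + \<tau> / 2}")
      case True
      then have "\<bar>y - x\<bar> \<le> \<tau> / 2" unfolding atLeastAtMost_iff by linarith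
      then have "\<bar>(y - x) / \<tau>\<bar> \<le> 1/2" using \<tau> by (simp add: abs_divide divide_simps)
      then have "\<bar>(y - x) / \<tau>\<bar>\<^sup>2 \<le> (1/2)\<^sup>2" by (intro power_mono) auto
      then have "1 / 2 \<le> 1 + (- ((y - x) / \<tau>)\<^sup>2 / 2)" unfolding power2_abs by (simp add: power2_eq_square[of "1/2"])
      also have "\<dots> \<le> exp (- ((y - x) / \<tau>)\<^sup>2 / 2)" by (rule exp_ge_add_one_self)
      finally show ?thesis using True by simp
    qed simp
  qed (auto simp: less_top[symmetric])
  also have "\<dots> = 2 * (\<integral>y. (\<integral>t. cos ((y - x) / \<tau> * t) \<partial>gauss) \<partial>M)"
    unfolding gauss_cos by simp
  also have "(\<integral>y. (\<integral>t. cos ((y - x) / \<tau> * t) \<partial>gauss) \<partial>M) = (\<integral>t. (\<integral>y. cos ((y - x) / \<tau> * t) \<partial>M) \<partial>gauss)"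
    using P.Fubini_integral[OF int] by simp
  also have "\<dots> \<le> (\<integral>t. norm (char M (t / \<tau>)) \<partial>gauss)"
  proof (rule integral_mono)
    show "integrable gauss (\<lambda>t. \<integral>y. cos ((y - x) / \<tau> * t) \<partial>M)"
      using P.integrable_snd[OF int] by simp
    show "integrable gauss (\<lambda>t. norm (char M (t / \<tau>)))"
      by (rule integrable_gauss[where B = 1]) (auto simp: M.cmod_char_le_1)
    fix t :: real
    have ii: "integrable M (\<lambda>y. iexp (t / \<tau> * y))" by (rule M.integrable_iexp) auto
    have "(\<integral>y. cos ((y - x) / \<tau> * t) \<partial>M) = (\<integral>y. Re (iexp (- (t / \<tau> * x)) * iexp (t / \<tau> * y)) \<partial>M)"
      by (intro Bochner_Integration.integral_cong refl)
        (simp only: exp_add[symmetric], simp add: Re_exp diff_divide_distrib algebra_simps)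
    also have "\<dots> = Re (iexp (- (t / \<tau> * x)) * char M (t / \<tau>))"
      unfolding char_def using ii by (subst integral_Re) auto
    also have "\<dots> \<le> norm (iexp (- (t / \<tau> * x)) * char M (t / \<tau>))" by (rule complex_Re_le_cmod)
    also have "\<dots> = norm (char M (t / \<tau>))" unfolding norm_mult norm_exp_i_times by simp
    finally show "(\<integral>y. cos ((y - x) / \<tau> * t) \<partial>M) \<le> norm (char M (t / \<tau>))" .
  qed
  finally show "measure M {x - \<tau> / 2 .. x + \<tau> / 2} \<le> 2 * (\<integral>t. norm (char M (t / \<tau>)) \<partial>gauss)" by simp
qed simp

text \<open>The squared modulus is the characteristic function of the difference of two independent copies, and
\<open>z \<le> exp (z - 1)\<close>.\<close>

lemma norm_char_le_exp:
  assumes "real_distribution F"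
  shows "norm (char F s) \<le> exp (- (\<integral>\<omega>. 1 - cos (s * (fst \<omega> - snd \<omega>)) \<partial>(F \<Otimes>\<^sub>M F)) / 2)"
proof -
  interpret F: real_distribution F by fact
  interpret P: pair_prob_space F F ..
  have ii: "integrable F (\<lambda>y. iexp (s * y))" by (rule F.integrable_iexp) auto
  have Re: "Re (char F s) = (\<integral>x. cos (s * x) \<partial>F)" and Im: "Im (char F s) = (\<integral>x. sin (s * x) \<partial>F)"
    unfolding char_def using ii
    by (subst integral_Re[symmetric] integral_Im[symmetric]; simp add: Re_exp Im_exp)+
  have intc: "integrable F (\<lambda>x. cos (s * x))" and ints: "integrable F (\<lambda>x. sin (s * x))"
    by (rule F.integrable_const_bound[where B = 1]; auto)+
  have int: "integrable (F \<Otimes>\<^sub>M F) (\<lambda>\<omega>. cos (s * (fst \<omega> - snd \<omega>)))"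
    by (rule P.integrable_const_bound[where B = 1]) auto
  have "(\<integral>\<omega>. cos (s * (fst \<omega> - snd \<omega>)) \<partial>(F \<Otimes>\<^sub>M F)) = (\<integral>x. (\<integral>y. cos (s * (x - y)) \<partial>F) \<partial>F)"
    using P.integral_fst'[OF int] by simp
  also have "\<dots> = (\<integral>x. cos (s * x) * (\<integral>y. cos (s * y) \<partial>F) + sin (s * x) * (\<integral>y. sin (s * y) \<partial>F) \<partial>F)"
    using intc ints by (simp add: right_diff_distrib cos_diff)
  also have "\<dots> = (norm (char F s))\<^sup>2"
    unfolding cmod_power2 Re Im using intc ints by (simp add: power2_eq_square)
  finally have sq: "(\<integral>\<omega>. 1 - cos (s * (fst \<omega> - snd \<omega>)) \<partial>(F \<Otimes>\<^sub>M F)) = 1 - (norm (char F s))\<^sup>2"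
    using int P.prob_space by simp
  have "(norm (char F s))\<^sup>2 \<le> exp ((norm (char F s))\<^sup>2 - 1)"
    using exp_ge_add_one_self[of "(norm (char F s))\<^sup>2 - 1"] by simp
  also have "\<dots> = (exp (- (1 - (norm (char F s))\<^sup>2) / 2))\<^sup>2"
    by (simp add: exp_double[symmetric] power2_eq_square exp_add[symmetric])
  finally show ?thesis unfolding sq by (rule power2_le_imp_le) simp
qed

lemma exp_le_lazy_cos:
  assumes "0 \<le> p" "p \<le> 1"
  shows "exp (- (p / 2) * (1 - cos u)) \<le> lazy_cos (p / 4) u"
proof -
  define x where "x = p / 2 * (1 - cos u)"
  have c: "0 \<le> 1 - cos u" "1 - cos u \<le> 2" using cos_ge_minus_one[of u] cos_le_one[of u] by linarith+
  have "x \<le> 1 / 2 * 2" unfolding x_def using assms c by (intro mult_mono) auto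
  moreover have "0 \<le> x" unfolding x_def using assms c by simp
  ultimately have x: "0 \<le> x" "x \<le> 1" by auto
  have "exp (- x) = inverse (exp x)" by (rule exp_minus)
  also have "\<dots> \<le> inverse (1 + x)" using x by (intro le_imp_inverse_le exp_ge_add_one_self) auto
  also have "\<dots> \<le> 1 - x / 2"
  proof -
    have "x * x \<le> x * 1" using x by (intro mult_left_mono) auto
    then have "1 \<le> (1 - x / 2) * (1 + x)" by (simp add: algebra_simps)
    then show ?thesis using x by (simp add: divide_simps)
  qed
  finally show ?thesis by (simp add: x_def lazy_cos_def diff_divide_distrib algebra_simps)
qed

lemma diff_tail_eq:
  assumes "real_distribution F"
  shows "diff_tail F 1 = (\<integral>\<omega>. indicator {\<omega>. 1 < \<bar>fst \<omega> - snd \<omega>\<bar>} \<omega> \<partial>(F \<Otimes>\<^sub>M F))"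
    "{\<omega>. 1 < \<bar>fst \<omega> - snd \<omega>\<bar>} \<in> sets (F \<Otimes>\<^sub>M F)" "diff_tail F 1 \<le> 1"
proof -
  interpret F: real_distribution F by fact
  interpret P: pair_prob_space F F ..
  have "{\<omega> \<in> space (borel \<Otimes>\<^sub>M borel :: (real \<times> real) measure). 1 < \<bar>fst \<omega> - snd \<omega>\<bar>} \<in> sets (borel \<Otimes>\<^sub>M borel)"
    by measurable
  moreover have "sets (F \<Otimes>\<^sub>M F) = sets (borel \<Otimes>\<^sub>M borel)" by (intro sets_pair_measure_cong) auto
  ultimately show "{\<omega>. 1 < \<bar>fst \<omega> - snd \<omega>\<bar>} \<in> sets (F \<Otimes>\<^sub>M F)" by (simp add: space_pair_measure)
  show "diff_tail F 1 = (\<integral>\<omega>. indicator {\<omega>. 1 < \<bar>fst \<omega> - snd \<omega>\<bar>} \<omega> \<partial>(F \<Otimes>\<^sub>M F))"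
    by (simp add: diff_tail_def case_prod_unfold space_pair_measure)
  show "diff_tail F 1 \<le> 1" unfolding diff_tail_def by (rule P.prob_le_1)
qed

text \<open>This reduces an arbitrary law \<open>F\<close> to lazy signs with one common random factor.  The moduli are bounded by exponentials of integrals over
\<open>y = fst \<omega> - snd \<omega>\<close>, of which only the part with \<open>\<bar>y\<bar> > 1\<close> is kept.  Jensen's inequality takes the average over
\<open>y\<close> out of the exponential; the same \<open>y\<close> then multiplies all coefficients, and by \<open>\<bar>y\<bar> > 1\<close> this rescaling
preserves dissociation.\<close>

lemma prod_norm_char_le:
  assumes F: "real_distribution F" and p: "0 < diff_tail F 1" and A: "finite A"
  shows "(\<Prod>k\<in>A. norm (char F (b k))) \<le> 1 / diff_tail F 1 *
    (\<integral>\<omega>. indicator {\<omega>. 1 < \<bar>fst \<omega> - snd \<omega>\<bar>} \<omega> *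
       (\<Prod>k\<in>A. lazy_cos (diff_tail F 1 / 4) (b k * (fst \<omega> - snd \<omega>))) \<partial>(F \<Otimes>\<^sub>M F))"
proof -
  interpret F: real_distribution F by fact
  interpret P: pair_prob_space F F ..
  let ?p = "diff_tail F 1"
  let ?D = "{\<omega> :: real \<times> real. 1 < \<bar>fst \<omega> - snd \<omega>\<bar>}"
  have D[measurable]: "?D \<in> sets (F \<Otimes>\<^sub>M F)" and pD: "?p = (\<integral>\<omega>. indicator ?D \<omega> \<partial>(F \<Otimes>\<^sub>M F))"
    and p1: "?p \<le> 1" using diff_tail_eq[OF F] by auto
  define h where "h \<omega> = (\<Sum>k\<in>A. 1 - cos (b k * (fst \<omega> - snd \<omega>)))" for \<omega> :: "real \<times> real"
  have intk: "integrable (F \<Otimes>\<^sub>M F) (\<lambda>\<omega>. 1 - cos (b k * (fst \<omega> - snd \<omega>)))" for k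
  proof (rule P.integrable_const_bound[where B = 2])
    have "\<bar>1 - cos x\<bar> \<le> 2" for x :: real
      using cos_ge_minus_one[of x] cos_le_one[of x] by (simp add: abs_le_iff)
    then show "AE \<omega> in F \<Otimes>\<^sub>M F. norm (1 - cos (b k * (fst \<omega> - snd \<omega>))) \<le> 2" by simp
  qed auto
  have inth: "integrable (F \<Otimes>\<^sub>M F) h" unfolding h_def using intk by simp
  have h0: "0 \<le> h \<omega>" for \<omega> unfolding h_def by (intro sum_nonneg) simp
  have intDh: "integrable (F \<Otimes>\<^sub>M F) (\<lambda>\<omega>. indicator ?D \<omega> * h \<omega>)"
    using integrable_mult_indicator[OF D inth] by simp
  have intD: "integrable (F \<Otimes>\<^sub>M F) (\<lambda>\<omega>. indicator ?D \<omega> :: real)"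
    using D by (simp add: less_top[symmetric])
  have intL: "integrable (F \<Otimes>\<^sub>M F) (\<lambda>\<omega>. indicator ?D \<omega> * (\<Prod>k\<in>A. lazy_cos (?p / 4) (b k * (fst \<omega> - snd \<omega>))))"
    using p p1 by (intro P.integrable_const_bound[where B = 1])
      (auto simp: abs_mult indicator_def intro!: AE_I2 abs_prod_lazy_cos_le_one)
  define m where "m = (\<integral>\<omega>. indicator ?D \<omega> * h \<omega> \<partial>(F \<Otimes>\<^sub>M F)) / 2"
  have "(\<Prod>k\<in>A. norm (char F (b k))) \<le> (\<Prod>k\<in>A. exp (- (\<integral>\<omega>. 1 - cos (b k * (fst \<omega> - snd \<omega>)) \<partial>(F \<Otimes>\<^sub>M F)) / 2))"
    by (intro prod_mono conjI norm_char_le_exp[OF F]) auto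
  also have "\<dots> = exp (- (\<integral>\<omega>. h \<omega> \<partial>(F \<Otimes>\<^sub>M F)) / 2)"
    unfolding h_def using intk by (simp add: exp_sum[OF A, symmetric] sum_negf sum_divide_distrib)
  also have "\<dots> \<le> exp (- m)"
  proof -
    have "(\<integral>\<omega>. indicator ?D \<omega> * h \<omega> \<partial>(F \<Otimes>\<^sub>M F)) \<le> (\<integral>\<omega>. h \<omega> \<partial>(F \<Otimes>\<^sub>M F))"
      using h0 by (intro integral_mono intDh inth) (auto simp: indicator_def)
    then show ?thesis by (simp add: m_def)
  qed
  \<comment> \<open>Jensen's inequality for the law conditioned on D, in the form of a tangent line of exp at -m.\<close>
  also have "exp (- m) = 1 / ?p * (\<integral>\<omega>. indicator ?D \<omega> * (exp (- m) * (1 + m)) - exp (- m) * (?p / 2) * (indicator ?D \<omega> * h \<omega>) \<partial>(F \<Otimes>\<^sub>M F))"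
  proof -
    have "(\<integral>\<omega>. indicator ?D \<omega> * (exp (- m) * (1 + m)) - exp (- m) * (?p / 2) * (indicator ?D \<omega> * h \<omega>) \<partial>(F \<Otimes>\<^sub>M F))
      = ?p * (exp (- m) * (1 + m)) - exp (- m) * (?p / 2) * (2 * m)"
      using intD intDh D by (simp add: pD m_def)
    also have "\<dots> = ?p * exp (- m)" by (simp add: algebra_simps)
    finally show ?thesis using p by simp
  qed
  also have "\<dots> \<le> 1 / ?p * (\<integral>\<omega>. indicator ?D \<omega> * (\<Prod>k\<in>A. lazy_cos (?p / 4) (b k * (fst \<omega> - snd \<omega>))) \<partial>(F \<Otimes>\<^sub>M F))"
  proof (intro mult_left_mono integral_mono intL)
    fix \<omega>
    \<comment> \<open>The slope \<open>p / 2\<close> makes the mean of the exponent over D equal to \<open>- m\<close>.\<close>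
    have "exp (- m) * (1 + m - ?p / 2 * h \<omega>) \<le> exp (- m) * exp (m - ?p / 2 * h \<omega>)"
      using exp_ge_add_one_self[of "m - ?p / 2 * h \<omega>"] by (intro mult_left_mono) (auto simp: algebra_simps)
    also have "\<dots> = exp (- (?p / 2) * h \<omega>)" by (simp add: exp_add[symmetric])
    also have "\<dots> = (\<Prod>k\<in>A. exp (- (?p / 2) * (1 - cos (b k * (fst \<omega> - snd \<omega>)))))"
      unfolding h_def sum_distrib_left exp_sum[OF A] ..
    also have "\<dots> \<le> (\<Prod>k\<in>A. lazy_cos (?p / 4) (b k * (fst \<omega> - snd \<omega>)))"
      using p p1 by (intro prod_mono conjI exp_le_lazy_cos) auto
    finally show "indicator ?D \<omega> * (exp (- m) * (1 + m)) - exp (- m) * (?p / 2) * (indicator ?D \<omega> * h \<omega>)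
       \<le> indicator ?D \<omega> * (\<Prod>k\<in>A. lazy_cos (?p / 4) (b k * (fst \<omega> - snd \<omega>)))"
      by (auto simp: indicator_def algebra_simps)
  qed (use p intD intDh in auto)
  finally show ?thesis .
qed

lemma char_weighted_sum:
  assumes "real_distribution F" and I: "finite I"
  shows "char (distr (Pi\<^sub>M I (\<lambda>_. F)) borel (\<lambda>x. \<Sum>k\<in>I. x k * b k)) t = (\<Prod>k\<in>I. char F (b k * t))"
    and "real_distribution (distr (Pi\<^sub>M I (\<lambda>_. F)) borel (\<lambda>x. \<Sum>k\<in>I. x k * b k))"
proof -
  interpret F: real_distribution F by fact
  interpret product_prob_space "\<lambda>_. F" I ..
  have PI: "prob_space (Pi\<^sub>M I (\<lambda>_. F))" by (intro prob_space_PiM F.prob_space_axioms)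
  have m[measurable]: "(\<lambda>x. \<Sum>k\<in>I. x k * b k) \<in> borel_measurable (Pi\<^sub>M I (\<lambda>_. F))" by measurable
  show "real_distribution (distr (Pi\<^sub>M I (\<lambda>_. F)) borel (\<lambda>x. \<Sum>k\<in>I. x k * b k))"
    using prob_space.prob_space_distr[OF PI m] by (simp add: real_distribution_def real_distribution_axioms_def)
  have "char (distr (Pi\<^sub>M I (\<lambda>_. F)) borel (\<lambda>x. \<Sum>k\<in>I. x k * b k)) t
    = (\<integral>x. iexp (t * (\<Sum>k\<in>I. x k * b k)) \<partial>Pi\<^sub>M I (\<lambda>_. F))"
    unfolding char_def by (subst integral_distr) auto
  also have "\<dots> = (\<integral>x. (\<Prod>k\<in>I. iexp (b k * t * x k)) \<partial>Pi\<^sub>M I (\<lambda>_. F))"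
    by (simp add: exp_sum[OF I, symmetric] sum_distrib_left mult_ac)
  also have "\<dots> = (\<Prod>k\<in>I. \<integral>x. iexp (b k * t * x) \<partial>F)"
    using I by (intro product_integral_prod F.integrable_iexp) auto
  finally show "char (distr (Pi\<^sub>M I (\<lambda>_. F)) borel (\<lambda>x. \<Sum>k\<in>I. x k * b k)) t = (\<Prod>k\<in>I. char F (b k * t))"
    by (simp add: char_def)
qed

text \<open>After exchanging the two integrals, the inner Gaussian average is that of \<open>lazy_product_bound\<close> for the scale
\<open>s = y / \<tau>\<close> with \<open>\<bar>y\<bar> > 1\<close>, whose bound does not depend on \<open>y\<close>.\<close>

lemma conc_fun_bound:
  fixes a :: "'i \<Rightarrow> real"
  assumes F: "real_distribution F" and p: "0 < diff_tail F 1" and A: "finite A"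
    and \<delta>: "0 < \<delta>" "\<delta> \<le> \<tau>"
    and many: "\<And>J. J \<subseteq> A \<Longrightarrow> dissociated \<delta> a J \<Longrightarrow> card J < r \<Longrightarrow>
        N \<le> card {k\<in>A. \<forall>z\<in>cube_span a J. \<delta> < \<bar>a k - z\<bar>}"
  shows "conc_fun (distr (Pi\<^sub>M A (\<lambda>_. F)) borel (\<lambda>x. \<Sum>k\<in>A. x k * a k)) \<tau>
    \<le> 2 * ((1/2) ^ r * (16 * (\<tau> / \<delta>)\<^sup>2) + 2 ^ r * (1 - diff_tail F 1 / 8) ^ N)"
proof -
  interpret F: real_distribution F by fact
  interpret P: pair_prob_space F F ..
  interpret PG: pair_prob_space "F \<Otimes>\<^sub>M F" gauss ..
  let ?p = "diff_tail F 1"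
  let ?D = "{\<omega> :: real \<times> real. 1 < \<bar>fst \<omega> - snd \<omega>\<bar>}"
  have D[measurable]: "?D \<in> sets (F \<Otimes>\<^sub>M F)" and pD: "?p = (\<integral>\<omega>. indicator ?D \<omega> \<partial>(F \<Otimes>\<^sub>M F))"
    and p1: "?p \<le> 1" using diff_tail_eq[OF F] by auto
  let ?B = "(1/2) ^ r * (16 * (\<tau> / \<delta>)\<^sup>2) + 2 ^ r * (1 - ?p / 8) ^ N"
  let ?M = "distr (Pi\<^sub>M A (\<lambda>_. F)) borel (\<lambda>x. \<Sum>k\<in>A. x k * a k)"
  let ?f = "\<lambda>\<omega> t. indicator ?D \<omega> * (\<Prod>k\<in>A. lazy_cos (?p / 4) (a k * (t / \<tau>) * (fst \<omega> - snd \<omega>)))"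
  have \<tau>: "0 < \<tau>" using \<delta> by simp
  have f1: "\<bar>?f \<omega> t\<bar> \<le> 1" for \<omega> t
    using p p1 by (auto simp: abs_mult indicator_def intro!: abs_prod_lazy_cos_le_one)
  have int: "integrable ((F \<Otimes>\<^sub>M F) \<Otimes>\<^sub>M gauss) (\<lambda>(\<omega>, t). ?f \<omega> t)"
    using f1 by (intro PG.integrable_const_bound[where B = 1]) auto
  have "conc_fun ?M \<tau> \<le> 2 * (\<integral>t. norm (char ?M (t / \<tau>)) \<partial>gauss)"
    by (rule conc_fun_le_gauss[OF char_weighted_sum(2)[OF F A] \<tau>])
  also have "(\<integral>t. norm (char ?M (t / \<tau>)) \<partial>gauss) \<le> (\<integral>t. 1 / ?p * (\<integral>\<omega>. ?f \<omega> t \<partial>(F \<Otimes>\<^sub>M F)) \<partial>gauss)"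
  proof (rule integral_mono)
    show "integrable gauss (\<lambda>t. norm (char ?M (t / \<tau>)))"
      using real_distribution.cmod_char_le_1[OF char_weighted_sum(2)[OF F A]]
        real_distribution.char_measurable[OF char_weighted_sum(2)[OF F A]]
      by (intro integrable_gauss[where B = 1]) auto
    show "integrable gauss (\<lambda>t. 1 / ?p * (\<integral>\<omega>. ?f \<omega> t \<partial>(F \<Otimes>\<^sub>M F)))"
      using PG.integrable_snd[OF int] by simp
    show "norm (char ?M (t / \<tau>)) \<le> 1 / ?p * (\<integral>\<omega>. ?f \<omega> t \<partial>(F \<Otimes>\<^sub>M F))" for t
      unfolding char_weighted_sum(1)[OF F A] prod_norm[symmetric] by (rule prod_norm_char_le[OF F p A])
  qed
  also have "\<dots> = 1 / ?p * (\<integral>\<omega>. (\<integral>t. ?f \<omega> t \<partial>gauss) \<partial>(F \<Otimes>\<^sub>M F))"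
    using PG.Fubini_integral[OF int] by simp
  also have "\<dots> \<le> 1 / ?p * (\<integral>\<omega>. indicator ?D \<omega> * ?B \<partial>(F \<Otimes>\<^sub>M F))"
  proof (intro mult_left_mono integral_mono)
    show "integrable (F \<Otimes>\<^sub>M F) (\<lambda>\<omega>. \<integral>t. ?f \<omega> t \<partial>gauss)"
      using PG.integrable_fst[OF int] by simp
    show "integrable (F \<Otimes>\<^sub>M F) (\<lambda>\<omega>. indicator ?D \<omega> * ?B)"
      using D by (simp add: less_top[symmetric])
    fix \<omega> :: "real \<times> real"
    let ?s = "(fst \<omega> - snd \<omega>) / \<tau>"
    show "(\<integral>t. ?f \<omega> t \<partial>gauss) \<le> indicator ?D \<omega> * ?B"
    proof (cases "\<omega> \<in> ?D")
      case True
      then have "\<delta> * 1 / \<tau> \<le> \<delta> * \<bar>fst \<omega> - snd \<omega>\<bar> / \<tau>" using \<delta>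
        by (intro divide_right_mono mult_left_mono) auto
      then have "\<delta> / \<tau> \<le> \<bar>?s\<bar> * \<delta>" using \<tau> by (simp add: abs_divide mult_ac)
      then have "(\<integral>t. (\<Prod>k\<in>A. lazy_cos (?p / 4) (?s * a k * t)) \<partial>gauss)
          \<le> (1/2) ^ r * (16 / (\<delta> / \<tau>)\<^sup>2) + 2 ^ r * (1 - (?p / 4) / 2) ^ N"
        using \<delta> p p1 by (intro lazy_product_bound[OF A _ _ _ _ _ many]) auto
      also have "\<dots> = ?B" by (simp add: power_divide)
      finally show ?thesis using True by (simp add: mult_ac)
    qed simp
  qed (use p in auto)
  also have "\<dots> = ?B" using p pD by simp
  finally show ?thesis by simp
qed

section \<open>The one-dimensional structure theorem\<close>

lemma
  assumes "real_distribution M"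
  shows bdd_above_conc_fun: "bdd_above (range (\<lambda>x. measure M {x - l / 2 .. x + l / 2}))"
    and conc_fun_le_one: "conc_fun M l \<le> 1"
    and conc_fun_nonneg: "0 \<le> conc_fun M l"
proof -
  interpret M: real_distribution M by fact
  show bdd: "bdd_above (range (\<lambda>x. measure M {x - l / 2 .. x + l / 2}))"
    by (rule bdd_aboveI[of _ 1]) auto
  show "conc_fun M l \<le> 1" unfolding conc_fun_def by (rule cSUP_least) auto
  have "0 \<le> measure M {0 - l / 2 .. 0 + l / 2}" by simp
  also have "\<dots> \<le> conc_fun M l" unfolding conc_fun_def by (rule cSUP_upper[OF _ bdd]) simp
  finally show "0 \<le> conc_fun M l" .
qed

lemma conc_fun_mono:
  assumes "real_distribution M" "l \<le> l'"
  shows "conc_fun M l \<le> conc_fun M l'"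
proof -
  interpret M: real_distribution M by fact
  show ?thesis unfolding conc_fun_def
  proof (rule cSUP_mono[OF _ bdd_above_conc_fun[OF assms(1)]])
    show "\<exists>y\<in>UNIV. measure M {x - l / 2 .. x + l / 2} \<le> measure M {y - l' / 2 .. y + l' / 2}" for x
      using assms(2) by (intro bexI[of _ x] M.finite_measure_mono) auto
  qed simp
qed

text \<open>If every dissociated family with fewer than \<open>r\<close> elements left \<open>N\<close> coefficients uncovered, then
\<open>conc_fun_bound\<close> would apply.  For \<open>r\<close> of order \<open>log (T\<^sup>2 / q)\<close>, where \<open>T = \<tau> / \<delta>\<close>, and \<open>N\<close> of order \<open>r / p\<close>, where \<open>p = diff_tail F 1\<close>,
both of its terms would be a small multiple of \<open>q\<close>, a contradiction.\<close>

lemma exists_dissociated_pos: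
  fixes a :: "'i \<Rightarrow> real"
  assumes F: "real_distribution F" and p: "0 < diff_tail F 1" and A: "finite A"
    and \<delta>: "0 < \<delta>" "\<delta> \<le> \<tau>"
    and q: "q = conc_fun (distr (Pi\<^sub>M A (\<lambda>_. F)) borel (\<lambda>x. \<Sum>k\<in>A. x k * a k)) \<tau>" "0 < q"
    and L: "L = \<bar>ln q\<bar> + ln (\<tau> / \<delta>) + 1"
  shows "\<exists>J\<subseteq>A. dissociated \<delta> a J \<and> real (card J) \<le> 8 * L
    \<and> diff_tail F 1 * real (card {k\<in>A. \<forall>z\<in>cube_span a J. \<delta> < \<bar>a k - z\<bar>}) \<le> 136 * L"
proof -
  let ?p = "diff_tail F 1"
  let ?far = "\<lambda>J. {k\<in>A. \<forall>z\<in>cube_span a J. \<delta> < \<bar>a k - z\<bar>}"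
  define T where "T = \<tau> / \<delta>"
  have T: "1 \<le> T" using \<delta> by (simp add: T_def)
  have p1: "?p \<le> 1" by (rule diff_tail_eq[OF F])
  have q1: "q \<le> 1" unfolding q by (rule conc_fun_le_one[OF char_weighted_sum(2)[OF F A]])
  \<comment> \<open>With \<open>2 ^ r \<ge> 128 * T\<^sup>2 / q\<close> the main term of the bound is at most \<open>q / 4\<close>.\<close>
  define Y where "Y = 128 * T\<^sup>2 / q"
  have T2: "1 \<le> T\<^sup>2" using T by simp
  have Y: "128 \<le> Y"
  proof -
    have "128 * q \<le> 128 * T\<^sup>2" using T2 q1 by simp
    then show ?thesis using q(2) by (simp add: Y_def field_simps)
  qed
  define r where "r = nat \<lceil>log 2 Y\<rceil>"
  \<comment> \<open>Then \<open>(1 - p / 8) ^ N \<le> exp (- 2 * r) \<le> 4 ^ (- r)\<close> absorbs the factor \<open>2 ^ r\<close>.\<close>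
  define N where "N = nat \<lceil>16 * real r / ?p\<rceil>"
  have log0: "0 < log 2 Y" using Y by simp
  have r_pos: "1 \<le> r" using log0 unfolding r_def by linarith
  have Yr: "Y \<le> 2 ^ r"
  proof -
    have "log 2 Y \<le> real r" unfolding r_def by linarith
    then show ?thesis using Y by (simp add: log_le_iff powr_realpow)
  qed
  have logY: "log 2 Y = 7 + 2 * log 2 T + log 2 (1 / q)"
  proof -
    have "log 2 (128::real) = log 2 (2 ^ 7)" by simp
    also have "\<dots> = 7" by (subst log_nat_power) auto
    finally have "log 2 (128::real) = 7" .
    then show ?thesis using T q(2) unfolding Y_def
      by (simp add: log_mult log_divide log_nat_power)
  qed
  have log_ln: "log 2 x \<le> 2 * ln x" if "1 \<le> x" for x :: real
  proof -
    have "ln x * 1 \<le> ln x * (2 * ln 2)" using that ln2_ge_two_thirds by (intro mult_left_mono) auto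
    then show ?thesis by (simp add: log_def field_simps)
  qed
  have lnT: "0 \<le> ln T" using T by simp
  have lnq: "ln (1 / q) = \<bar>ln q\<bar>" using q(2) q1 by (simp add: ln_div)
  have "real r \<le> log 2 Y + 1" unfolding r_def using log0 by linarith
  also have "\<dots> \<le> 8 + 4 * ln T + 2 * \<bar>ln q\<bar>"
    using log_ln[OF T] log_ln[of "1 / q"] q(2) q1 lnq unfolding logY by simp
  also have "\<dots> \<le> 8 * L" unfolding L T_def[symmetric] using lnT by simp
  finally have rL: "real r \<le> 8 * L" .
  have N: "real N * ?p \<le> 17 * real r"
  proof -
    have "0 \<le> 16 * real r / ?p" using p by simp
    then have "real N \<le> 16 * real r / ?p + 1" unfolding N_def by linarith
    then have "real N * ?p \<le> (16 * real r / ?p + 1) * ?p" using p by (intro mult_right_mono) auto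
    also have "\<dots> = 16 * real r + ?p" using p by (simp add: field_simps)
    finally show ?thesis using p1 r_pos by simp
  qed
  have "\<exists>J\<subseteq>A. dissociated \<delta> a J \<and> card J < r \<and> card (?far J) < N"
  proof (rule ccontr)
    assume "\<not> ?thesis"
    then have "N \<le> card (?far J)" if "J \<subseteq> A" "dissociated \<delta> a J" "card J < r" for J
      using that by (meson not_less)
    from conc_fun_bound[OF F p A \<delta> this]
    have q_le: "q \<le> 2 * ((1/2) ^ r * (16 * T\<^sup>2) + 2 ^ r * (1 - ?p / 8) ^ N)"
      unfolding q T_def by blast
    have half: "(1/2) ^ r \<le> q / (128 * T\<^sup>2)"
    proof -
      have "inverse (2 ^ r) \<le> inverse Y" using Yr Y by (intro le_imp_inverse_le) auto
      then show ?thesis by (simp add: Y_def power_one_over inverse_eq_divide)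
    qed
    then have "(1/2) ^ r * (16 * T\<^sup>2) \<le> q / (128 * T\<^sup>2) * (16 * T\<^sup>2)" by (intro mult_right_mono) auto
    also have "\<dots> = q / 8" using T by (simp add: field_simps)
    finally have 1: "(1/2) ^ r * (16 * T\<^sup>2) \<le> q / 8" .
    have "(1 - ?p / 8) ^ N \<le> exp (- (?p / 8)) ^ N"
      using p p1 exp_ge_add_one_self[of "- (?p / 8)"] by (intro power_mono) auto
    also have "\<dots> = exp (- (real N * ?p / 8))" by (simp add: exp_of_nat_mult[symmetric])
    also have "\<dots> \<le> exp (- (2 * real r))"
    proof -
      have "16 * real r / ?p \<le> real N" unfolding N_def by linarith
      then have "16 * real r \<le> real N * ?p" using p by (simp add: field_simps)
      then show ?thesis by simp
    qed
    also have "\<dots> = (exp (- 2)) ^ r" by (simp add: exp_of_nat_mult[symmetric] mult.commute)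
    also have "\<dots> \<le> (1 / 4) ^ r"
    proof (intro power_mono)
      have "(2::real) \<le> exp 1" using exp_ge_add_one_self[of 1] by simp
      then have "2 * 2 \<le> exp 1 * exp (1::real)" by (intro mult_mono) auto
      then have "4 \<le> exp (2::real)" by (simp add: exp_add[symmetric])
      then have "inverse (exp (2::real)) \<le> inverse 4" by (intro le_imp_inverse_le) auto
      then show "exp (- 2) \<le> 1 / (4::real)" by (simp add: exp_minus)
    qed simp
    finally have "2 ^ r * (1 - ?p / 8) ^ N \<le> 2 ^ r * (1 / 4) ^ r" by (intro mult_left_mono) auto
    also have "\<dots> = (1/2) ^ r" by (simp add: power_mult_distrib[symmetric])
    also have "\<dots> \<le> q / 128"
    proof -
      have "q / (128 * T\<^sup>2) \<le> q / 128" using T2 q(2) by (intro divide_left_mono) auto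
      then show ?thesis using half by linarith
    qed
    finally show False using 1 q_le q(2) by simp
  qed
  then obtain J where J: "J \<subseteq> A" "dissociated \<delta> a J" "card J < r" "card (?far J) < N" by blast
  have "?p * real (card (?far J)) \<le> ?p * real N" using J(4) p by (intro mult_left_mono) auto
  then have "?p * real (card (?far J)) \<le> 136 * L" using N rL by (simp add: mult.commute)
  then show ?thesis using J rL by (intro exI[of _ J]) auto
qed

lemma finite_cube_span:
  assumes "finite J" shows "finite (cube_span a J)"
proof -
  have "cube_span a J \<subseteq> (\<lambda>m. \<Sum>j\<in>J. real_of_int (m j) * a j) ` (J \<rightarrow>\<^sub>E {-1, 0, 1})"
  proof
    fix z assume "z \<in> cube_span a J"
    then obtain m where m: "m \<in> J \<rightarrow> {-1, 0, 1 :: int}" "z = (\<Sum>j\<in>J. real_of_int (m j) * a j)"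
      by (auto simp: cube_span_def)
    then show "z \<in> (\<lambda>m. \<Sum>j\<in>J. real_of_int (m j) * a j) ` (J \<rightarrow>\<^sub>E {-1, 0, 1})"
      by (intro image_eqI[of _ _ "restrict m J"]) auto
  qed
  then show ?thesis using assms by (rule finite_subset[OF _ finite_imageI[OF finite_PiE]]) auto
qed

text \<open>This adds the case \<open>\<tau> = \<delta> = 0\<close>, in which \<open>ln (\<tau> / \<delta>) = ln 0 = 0\<close> is the intended value, by a passage to
small positive scales.\<close>

lemma exists_dissociated:
  fixes a :: "'i \<Rightarrow> real"
  assumes F: "real_distribution F" and p: "0 < diff_tail F 1" and A: "finite A"
    and \<delta>: "0 \<le> \<delta>" "\<delta> \<le> \<tau>" and \<tau>: "\<delta> = 0 \<Longrightarrow> \<tau> = 0"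
    and q: "q = conc_fun (distr (Pi\<^sub>M A (\<lambda>_. F)) borel (\<lambda>x. \<Sum>k\<in>A. x k * a k)) \<tau>" "0 < q"
    and L: "L = \<bar>ln q\<bar> + ln (\<tau> / \<delta>) + 1"
  shows "\<exists>J\<subseteq>A. dissociated \<delta> a J \<and> real (card J) \<le> 8 * L
    \<and> diff_tail F 1 * real (card {k\<in>A. \<forall>z\<in>cube_span a J. \<delta> < \<bar>a k - z\<bar>}) \<le> 136 * L"
proof (cases "\<delta> = 0")
  case False
  then show ?thesis using \<delta> by (intro exists_dissociated_pos[OF F p A _ _ q L]) auto
next
  case True
  let ?M = "distr (Pi\<^sub>M A (\<lambda>_. F)) borel (\<lambda>x. \<Sum>k\<in>A. x k * a k)"
  have M: "real_distribution ?M" by (rule char_weighted_sum(2)[OF F A])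
  \<comment> \<open>Only finitely many distances occur, so a small positive scale does not see more than scale 0.\<close>
  define V where "V = (\<Union>k\<in>A. \<Union>J\<in>Pow A. (\<lambda>z. \<bar>a k - z\<bar>) ` cube_span a J)"
  have "finite V" unfolding V_def using A by (auto intro!: finite_cube_span intro: finite_subset)
  then have fin: "finite (insert 1 (V \<inter> {0<..}))" by simp
  define \<epsilon> where "\<epsilon> = Min (insert 1 (V \<inter> {0<..})) / 2"
  have "Min (insert 1 (V \<inter> {0<..})) \<in> insert 1 (V \<inter> {0<..})" using fin by (intro Min_in) auto
  then have \<epsilon>: "0 < \<epsilon>" by (auto simp: \<epsilon>_def)
  have below: "\<epsilon> < v" if "v \<in> V" "0 < v" for v
  proof -
    have "Min (insert 1 (V \<inter> {0<..})) \<le> v" using fin that by (intro Min_le) auto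
    then show ?thesis using \<epsilon> by (simp add: \<epsilon>_def)
  qed
  define q' where "q' = conc_fun ?M \<epsilon>"
  have qq': "q \<le> q'" unfolding q q'_def using True \<tau> \<epsilon> by (intro conc_fun_mono[OF M]) auto
  have "q' \<le> 1" unfolding q'_def by (rule conc_fun_le_one[OF M])
  then have "\<bar>ln q'\<bar> \<le> \<bar>ln q\<bar>" using qq' q(2) by simp
  then have L': "\<bar>ln q'\<bar> + ln (\<epsilon> / \<epsilon>) + 1 \<le> L" using \<epsilon> True by (simp add: L)
  have "0 < q'" using qq' q(2) by simp
  from exists_dissociated_pos[OF F p A \<epsilon> order_refl q'_def this refl]
  obtain J where J: "J \<subseteq> A" "dissociated \<epsilon> a J"
     "real (card J) \<le> 8 * (\<bar>ln q'\<bar> + ln (\<epsilon> / \<epsilon>) + 1)"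
     "diff_tail F 1 * real (card {k\<in>A. \<forall>z\<in>cube_span a J. \<epsilon> < \<bar>a k - z\<bar>}) \<le> 136 * (\<bar>ln q'\<bar> + ln (\<epsilon> / \<epsilon>) + 1)"
    by blast
  have "dissociated \<delta> a J" using J(2) \<epsilon> True unfolding dissociated_def by fastforce
  moreover have "\<delta> < \<bar>a k - z\<bar> \<longleftrightarrow> \<epsilon> < \<bar>a k - z\<bar>" if "k \<in> A" "z \<in> cube_span a J" for k z
  proof -
    have "\<bar>a k - z\<bar> \<in> V" unfolding V_def using that J(1) by blast
    then show ?thesis using below[of "\<bar>a k - z\<bar>"] \<epsilon> True by auto
  qed
  then have "{k\<in>A. \<forall>z\<in>cube_span a J. \<delta> < \<bar>a k - z\<bar>} = {k\<in>A. \<forall>z\<in>cube_span a J. \<epsilon> < \<bar>a k - z\<bar>}" by auto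
  ultimately show ?thesis using J L' by (intro exI[of _ J]) auto
qed

lemma K1_real_eq_cube_span: "K1_real r u = cube_span u {1..r}"
  by (simp add: K1_real_def cube_span_def)

lemma dissociated_nonzero:
  assumes "finite J" "dissociated \<delta> a J" "0 \<le> \<delta>" "k \<in> J" shows "a k \<noteq> 0"
proof -
  let ?m = "\<lambda>j. if j = k then 1 else 0 :: int"
  have "(\<Sum>j\<in>J. real_of_int (?m j) * a j) = a k"
    using assms by (simp add: if_distrib[of "\<lambda>x. x * _"] if_distrib[of real_of_int] cong: if_cong)
  moreover have "\<delta> < \<bar>\<Sum>j\<in>J. real_of_int (?m j) * a j\<bar>"
    using assms(2,4) unfolding dissociated_def by (elim ballE[of _ _ ?m]) auto
  ultimately show ?thesis using assms(3) by auto
qed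

text \<open>An empty family is replaced by the single vector \<open>1\<close>, since at least one nonzero vector is required; this
only enlarges the set.\<close>

lemma cube_span_enumerate:
  assumes J: "finite J" "dissociated \<delta> a J" "0 \<le> \<delta>"
  shows "\<exists>(r::nat) u. 1 \<le> r \<and> r \<le> max 1 (card J) \<and> (\<forall>s\<in>{1..r}. u s \<noteq> 0) \<and> cube_span a J \<subseteq> K1_real r u"
proof (cases "J = {}")
  case True
  have "cube_span a J \<subseteq> K1_real 1 (\<lambda>_. 1)"
    unfolding True by (auto simp: cube_span_def K1_real_def intro!: exI[of _ "\<lambda>_. 0"])
  then show ?thesis by (intro exI[of _ 1] exI[of _ "\<lambda>_. 1"]) auto
next
  case False
  obtain h where h: "bij_betw h {1..card J} J" using ex_bij_betw_nat_finite_1[OF J(1)] by blast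
  have "cube_span a J \<subseteq> K1_real (card J) (a \<circ> h)"
  proof
    fix z assume "z \<in> cube_span a J"
    then obtain m where m: "m \<in> J \<rightarrow> {-1, 0, 1 :: int}" "z = (\<Sum>j\<in>J. real_of_int (m j) * a j)"
      by (auto simp: cube_span_def)
    have "z = (\<Sum>s=1..card J. real_of_int (m (h s)) * a (h s))"
      unfolding m(2) by (rule sum.reindex_bij_betw[OF h, symmetric])
    moreover have "m \<circ> h \<in> {1..card J} \<rightarrow> {-1, 0, 1}" 
    proof
      fix s assume "s \<in> {1..card J}"
      then show "(m \<circ> h) s \<in> {-1, 0, 1}" using m(1) bij_betwE[OF h] unfolding comp_def by blast
    qed
    ultimately show "z \<in> K1_real (card J) (a \<circ> h)"
      unfolding K1_real_def by (intro CollectI exI[of _ "m \<circ> h"]) auto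
  qed
  moreover have "\<forall>s\<in>{1..card J}. (a \<circ> h) s \<noteq> 0"
    using dissociated_nonzero[OF J] h by (auto simp: bij_betw_def)
  ultimately show ?thesis using False J(1)
    by (intro exI[of _ "card J"] exI[of _ "a \<circ> h"]) (auto simp: Suc_le_eq card_gt_0_iff)
qed

text \<open>The theorem in one dimension; the factor \<open>2\<close> accounts for the masses at \<open>a k\<close> and \<open>- a k\<close>.\<close>

lemma coordinate_structure:
  fixes a :: "nat \<Rightarrow> real" and n :: nat
  assumes F: "real_distribution F" and p: "0 < diff_tail F 1"
    and \<delta>: "0 \<le> \<delta>" "\<delta> \<le> \<tau>"
    and L: "L = abs_log (conc_fun (distr (Pi\<^sub>M {1..n} (\<lambda>_. F)) borel (\<lambda>x. \<Sum>k=1..n. x k * a k)) \<tau>)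
        + log_ratio \<tau> \<delta> + 1"
  shows "\<exists>(r::nat) u. 1 \<le> r \<and> (\<forall>s\<in>{1..r}. u s \<noteq> 0) \<and> ereal (real r) \<le> ereal 272 * L \<and>
    ereal (diff_tail F 1 * (2 * real (card {k\<in>{1..n}. a k \<notin> nbhd (K1_real r u) \<delta>}))) \<le> ereal 272 * L ^ 3"
proof -
  let ?M = "distr (Pi\<^sub>M {1..n} (\<lambda>_. F)) borel (\<lambda>x. \<Sum>k=1..n. x k * a k)"
  define q where "q = conc_fun ?M \<tau>"
  have M: "real_distribution ?M" by (rule char_weighted_sum(2)[OF F finite_atLeastAtMost])
  have q01: "0 \<le> q" "q \<le> 1" unfolding q_def by (rule conc_fun_nonneg[OF M] conc_fun_le_one[OF M])+
  show ?thesis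
  proof (cases "q = 0 \<or> (\<delta> = 0 \<and> \<tau> \<noteq> 0)")
    case True
    then have "L = \<infinity>" unfolding L q_def[symmetric] by (auto simp: abs_log_def log_ratio_def)
    then show ?thesis by (intro exI[of _ 1] exI[of _ "\<lambda>_. 1"]) (simp add: power3_eq_cube)
  next
    case False
    define l where "l = \<bar>ln q\<bar> + ln (\<tau> / \<delta>) + 1"
    have Ll: "L = ereal l"
      using False unfolding L q_def[symmetric] by (auto simp: abs_log_def log_ratio_def l_def one_ereal_def)
    have "0 \<le> ln (\<tau> / \<delta>)" using \<delta> by (cases "\<delta> = 0") auto
    then have l1: "1 \<le> l" by (simp add: l_def)
    have "0 < q" using False q01 by auto
    from exists_dissociated[OF F p _ \<delta> _ q_def this l_def] False
    obtain J where J: "J \<subseteq> {1..n}" "dissociated \<delta> a J" "real (card J) \<le> 8 * l"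
      "diff_tail F 1 * real (card {k\<in>{1..n}. \<forall>z\<in>cube_span a J. \<delta> < \<bar>a k - z\<bar>}) \<le> 136 * l"
      by auto
    have "finite J" using J(1) by (rule finite_subset) simp
    from cube_span_enumerate[OF this J(2) \<delta>(1)] obtain r u where
      ru: "1 \<le> r" "r \<le> max 1 (card J)" "\<forall>s\<in>{1..r}. u s \<noteq> 0" "cube_span a J \<subseteq> K1_real r u" by blast
    have "{k\<in>{1..n}. a k \<notin> nbhd (K1_real r u) \<delta>} \<subseteq> {k\<in>{1..n}. \<forall>z\<in>cube_span a J. \<delta> < \<bar>a k - z\<bar>}"
    proof safe
      fix k z assume k: "a k \<notin> nbhd (K1_real r u) \<delta>" and z: "z \<in> cube_span a J"
      show "\<delta> < \<bar>a k - z\<bar>"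
      proof (rule ccontr)
        assume "\<not> \<delta> < \<bar>a k - z\<bar>"
        then have "infdist (a k) (K1_real r u) \<le> \<delta>"
          using z ru(4) by (intro infdist_le2[of z]) (auto simp: dist_real_def)
        then show False using k by (simp add: nbhd_def)
      qed
    qed
    then have "card {k\<in>{1..n}. a k \<notin> nbhd (K1_real r u) \<delta>} \<le> card {k\<in>{1..n}. \<forall>z\<in>cube_span a J. \<delta> < \<bar>a k - z\<bar>}"
      by (intro card_mono) auto
    then have "diff_tail F 1 * real (card {k\<in>{1..n}. a k \<notin> nbhd (K1_real r u) \<delta>})
       \<le> diff_tail F 1 * real (card {k\<in>{1..n}. \<forall>z\<in>cube_span a J. \<delta> < \<bar>a k - z\<bar>})"
      using p by (intro mult_left_mono) auto
    then have "diff_tail F 1 * (2 * real (card {k\<in>{1..n}. a k \<notin> nbhd (K1_real r u) \<delta>})) \<le> 272 * l"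
      using J(4) by simp
    \<comment> \<open>The linear bound implies the cubic one because \<open>l \<ge> 1\<close>.\<close>
    also have "l \<le> l ^ 3" using l1 by (rule self_le_power) simp
    finally have "diff_tail F 1 * (2 * real (card {k\<in>{1..n}. a k \<notin> nbhd (K1_real r u) \<delta>})) \<le> 272 * l ^ 3"
      by simp
    moreover have "real r \<le> 272 * l"
    proof -
      have "real r \<le> max 1 (real (card J))" using ru(2) by linarith
      then show ?thesis using J(3) l1 by linarith
    qed
    ultimately show ?thesis using ru unfolding Ll by (intro exI[of _ r] exI[of _ u]) simp
  qed
qed

lemma uminus_nbhd_K1_real: "- x \<in> nbhd (K1_real r u) t \<longleftrightarrow> x \<in> nbhd (K1_real r u) t"
proof -
  have neg: "- z \<in> K1_real r u" if z: "z \<in> K1_real r u" for z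
  proof -
    obtain m where m: "m \<in> {1..r} \<rightarrow> {-1, 0, 1 :: int}" "z = (\<Sum>j=1..r. real_of_int (m j) * u j)"
      using z unfolding K1_real_def by blast
    have "- z = (\<Sum>j=1..r. real_of_int (- m j) * u j)" unfolding m(2) by (simp add: sum_negf)
    moreover have "(\<lambda>j. - m j) \<in> {1..r} \<rightarrow> {-1, 0, 1}" using m(1) by (auto simp: Pi_iff)
    ultimately show ?thesis unfolding K1_real_def by (intro CollectI exI[of _ "\<lambda>j. - m j"] conjI)
  qed
  then have K: "K1_real r u = uminus ` K1_real r u"
  proof (intro equalityI subsetI)
    show "z \<in> uminus ` K1_real r u" if "z \<in> K1_real r u" for z
      using neg[OF that] by (intro image_eqI[of _ _ "- z"]) simp_all
    show "z \<in> K1_real r u" if "z \<in> uminus ` K1_real r u" for z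
      using that neg by blast
  qed
  have ne: "K1_real r u \<noteq> {}" unfolding K1_real_def by (auto intro!: exI[of _ "\<lambda>_. 0"])
  have "dist (- x) (- z) = dist x z" for z
    by (simp add: dist_real_def abs_minus_commute)
  then have "infdist (- x) (uminus ` K1_real r u) = infdist x (K1_real r u)"
    using ne by (simp add: infdist_def image_image)
  then show ?thesis unfolding nbhd_def K[symmetric] by simp
qed

section \<open>Assembling the coordinates\<close>

text \<open>A point outside the product of the neighbourhoods violates the condition in some coordinate, and the one-dimensional sets are
symmetric.\<close>

lemma Mstar_le_sum_card:
  assumes a: "\<And>k. k \<in> {1..n} \<Longrightarrow> a k \<in> space (Rd d)"
  shows "Mstar d n a (space (Rd d) - Pi\<^sub>E {1..d} (\<lambda>j. nbhd (K1_real (r j) (u j)) (\<delta> j)))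
     \<le> (\<Sum>j=1..d. 2 * real (card {k\<in>{1..n}. a k j \<notin> nbhd (K1_real (r j) (u j)) (\<delta> j)}))"
proof -
  let ?N = "\<lambda>j. nbhd (K1_real (r j) (u j)) (\<delta> j)"
  let ?B = "space (Rd d) - Pi\<^sub>E {1..d} ?N"
  have ret: "measure (return (Rd d) x) B \<le> indicator B x" for x and B :: "(nat \<Rightarrow> real) set"
    by (cases "B \<in> sets (Rd d)") (auto simp: measure_return measure_notin_sets)
  have ind: "indicator ?B x \<le> (\<Sum>j=1..d. of_bool (x j \<notin> ?N j) :: real)" for x
  proof (cases "x \<in> ?B")
    case True
    then have "x \<in> extensional {1..d}" "x \<notin> Pi\<^sub>E {1..d} ?N" by (auto simp: space_PiM PiE_def)
    then obtain j where j: "j \<in> {1..d}" "x j \<notin> ?N j" unfolding PiE_iff by blast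
    then have "1 \<le> (\<Sum>j\<in>{j}. of_bool (x j \<notin> ?N j) :: real)" by simp
    also have "\<dots> \<le> (\<Sum>j=1..d. of_bool (x j \<notin> ?N j))" using j by (intro sum_mono2) auto
    finally show ?thesis using True by simp
  qed (auto intro!: sum_nonneg)
  have pair: "measure (return (Rd d) (a k)) ?B + measure (return (Rd d) (vneg d (a k))) ?B
      \<le> (\<Sum>j=1..d. 2 * of_bool (a k j \<notin> ?N j))" for k
  proof -
    have "measure (return (Rd d) (vneg d (a k))) ?B \<le> (\<Sum>j=1..d. of_bool (vneg d (a k) j \<notin> ?N j))"
      using ret ind by (rule order_trans)
    also have "\<dots> = (\<Sum>j=1..d. of_bool (a k j \<notin> ?N j))"
      by (intro sum.cong) (auto simp: vneg_def uminus_nbhd_K1_real)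
    finally have "measure (return (Rd d) (vneg d (a k))) ?B \<le> (\<Sum>j=1..d. of_bool (a k j \<notin> ?N j))" .
    moreover have "measure (return (Rd d) (a k)) ?B \<le> (\<Sum>j=1..d. of_bool (a k j \<notin> ?N j))"
      using ret ind by (rule order_trans)
    ultimately show ?thesis unfolding sum_distrib_left[symmetric] by linarith
  qed
  have "Mstar d n a ?B \<le> (\<Sum>k=1..n. \<Sum>j=1..d. 2 * of_bool (a k j \<notin> ?N j))"
    unfolding Mstar_def by (intro sum_mono pair)
  also have "\<dots> = (\<Sum>j=1..d. \<Sum>k=1..n. 2 * of_bool (a k j \<notin> ?N j))" by (rule sum.swap)
  also have "\<dots> = (\<Sum>j=1..d. 2 * real (card {k\<in>{1..n}. a k j \<notin> ?N j}))"
    by (simp add: sum_distrib_left[symmetric] sum_of_bool_eq Int_def)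
  finally show ?thesis .
qed

definition block_vectors :: "nat \<Rightarrow> (nat \<Rightarrow> nat) \<Rightarrow> (nat \<Rightarrow> nat \<Rightarrow> real) \<Rightarrow> nat \<Rightarrow> nat \<Rightarrow> real" where
  "block_vectors d r u s = (\<lambda>i\<in>{1..d}.
     if s \<in> {(\<Sum>j=1..i-1. r j)<..(\<Sum>j=1..i. r j)} then u i (s - (\<Sum>j=1..i-1. r j)) else 0)"

text \<open>The blocks \<open>{S (i - 1)<..S i}\<close> of indices are disjoint, so a choice of coefficients on \<open>{1..S d}\<close> is the same as
an independent choice in every coordinate; the block containing \<open>s\<close> is found as the least \<open>i\<close> with \<open>s \<le> S i\<close>.\<close>

lemma PiE_K1_real_eq_K1:
  "Pi\<^sub>E {1..d} (\<lambda>j. K1_real (r j) (u j)) = K1 d (\<Sum>j=1..d. r j) (block_vectors d r u)"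
proof -
  define S where "S k = (\<Sum>j=1..k. r j)" for k
  have S0: "S 0 = 0" by (simp add: S_def)
  have step: "S i = r i + S (i - 1)" if "1 \<le> i" for i
    using that by (cases i) (auto simp: S_def)
  have mono: "S i \<le> S k" if "i \<le> k" for i k
    unfolding S_def using that by (intro sum_mono2) auto
  have coord: "(\<Sum>s=1..S d. real_of_int (m s) * block_vectors d r u s i)
      = (\<Sum>j=1..r i. real_of_int (m (j + S (i - 1))) * u i j)" if i: "i \<in> {1..d}" for m i
  proof -
    have block: "block_vectors d r u s i = (if S (i - 1) < s \<and> s \<le> S i then u i (s - S (i - 1)) else 0)" for s
      using i by (simp add: block_vectors_def S_def)
    have "(\<Sum>s=1..S d. real_of_int (m s) * block_vectors d r u s i)
        = (\<Sum>s=1 + S (i - 1)..r i + S (i - 1). real_of_int (m s) * u i (s - S (i - 1)))"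
      using i step[of i] mono[of i d]
      by (intro sum.mono_neutral_cong_right) (auto simp: block)
    also have "\<dots> = (\<Sum>j=1..r i. real_of_int (m (j + S (i - 1))) * u i j)"
      by (subst sum.shift_bounds_cl_nat_ivl) simp
    finally show ?thesis .
  qed
  show ?thesis unfolding S_def[symmetric]
  proof (intro equalityI subsetI)
    fix x assume x: "x \<in> K1 d (S d) (block_vectors d r u)"
    then obtain m where m: "m \<in> {1..S d} \<rightarrow> {-1, 0, 1 :: int}"
      "x = (\<lambda>i\<in>{1..d}. \<Sum>s=1..S d. real_of_int (m s) * block_vectors d r u s i)"
      by (auto simp: K1_def)
    show "x \<in> Pi\<^sub>E {1..d} (\<lambda>j. K1_real (r j) (u j))"
    proof (rule PiE_I)
      fix i assume i: "i \<in> {1..d}"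
      have "(\<lambda>j. m (j + S (i - 1))) \<in> {1..r i} \<rightarrow> {-1, 0, 1}"
      proof
        fix j assume "j \<in> {1..r i}"
        then have "j + S (i - 1) \<in> {1..S d}" using step[of i] mono[of i d] i by auto
        then show "m (j + S (i - 1)) \<in> {-1, 0, 1}" using m(1) by blast
      qed
      then show "x i \<in> K1_real (r i) (u i)"
        unfolding m(2) K1_real_def using coord[OF i] i by auto
    qed (auto simp: m(2))
  next
    fix x assume x: "x \<in> Pi\<^sub>E {1..d} (\<lambda>j. K1_real (r j) (u j))"
    then have "\<forall>i\<in>{1..d}. \<exists>m. m \<in> {1..r i} \<rightarrow> {-1, 0, 1 :: int} \<and> x i = (\<Sum>j=1..r i. real_of_int (m j) * u i j)"
      by (auto simp: K1_real_def PiE_iff)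
    then obtain mm where mm: "\<And>i. i \<in> {1..d} \<Longrightarrow> mm i \<in> {1..r i} \<rightarrow> {-1, 0, 1 :: int}"
      "\<And>i. i \<in> {1..d} \<Longrightarrow> x i = (\<Sum>j=1..r i. real_of_int (mm i j) * u i j)" by metis
    define b where "b s = (LEAST i. s \<le> S i)" for s
    define m where "m s = mm (b s) (s - S (b s - 1))" for s
    have b: "b s = i" if "S (i - 1) < s" "s \<le> S i" for s i
      unfolding b_def
    proof (rule Least_equality)
      fix y assume "s \<le> S y"
      show "i \<le> y"
      proof (rule ccontr)
        assume "\<not> i \<le> y"
        then have "y \<le> i - 1" by simp
        from mono[OF this] show False using \<open>s \<le> S y\<close> that by simp
      qed
    qed fact
    have "m \<in> {1..S d} \<rightarrow> {-1, 0, 1}"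
    proof
      fix s assume s: "s \<in> {1..S d}"
      have le: "s \<le> S (b s)" unfolding b_def by (rule LeastI[of _ d]) (use s in auto)
      have bd: "b s \<le> d" unfolding b_def by (rule Least_le) (use s in auto)
      have b1: "1 \<le> b s" using le s S0 by (cases "b s") auto
      have "S (b s - 1) < s" using not_less_Least[of "b s - 1" "\<lambda>i. s \<le> S i"] b1
        unfolding b_def[symmetric] by simp
      then have "s - S (b s - 1) \<in> {1..r (b s)}" using le step[OF b1] by auto
      then show "m s \<in> {-1, 0, 1}" using mm(1)[of "b s"] b1 bd unfolding m_def by auto
    qed
    moreover have "x = (\<lambda>i\<in>{1..d}. \<Sum>s=1..S d. real_of_int (m s) * block_vectors d r u s i)"
    proof
      fix i
      show "x i = (\<lambda>i\<in>{1..d}. \<Sum>s=1..S d. real_of_int (m s) * block_vectors d r u s i) i"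
      proof (cases "i \<in> {1..d}")
        case True
        have coeff: "m (j + S (i - 1)) = mm i j" if "j \<in> {1..r i}" for j
          using b[of i "j + S (i - 1)"] step[of i] that True by (simp add: m_def)
        have "x i = (\<Sum>j=1..r i. real_of_int (m (j + S (i - 1))) * u i j)"
          unfolding mm(2)[OF True] by (intro sum.cong refl) (simp only: coeff)
        then show ?thesis unfolding coord[OF True, symmetric] using True by simp
      next
        case False
        then show ?thesis using x by (auto simp: PiE_iff extensional_def)
      qed
    qed
    ultimately show "x \<in> K1 d (S d) (block_vectors d r u)" unfolding K1_def by blast
  qed
qed

lemma block_vectors_block:
  assumes k: "k \<in> {1..d}" and s: "(\<Sum>j=1..k-1. r j) < s" "s \<le> (\<Sum>j=1..k. r j)"
  shows "block_vectors d r u s k = u k (s - (\<Sum>j=1..k-1. r j))"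
    and "i \<in> {1..d} \<Longrightarrow> i \<noteq> k \<Longrightarrow> block_vectors d r u s i = 0"
proof -
  show "block_vectors d r u s k = u k (s - (\<Sum>j=1..k-1. r j))"
    using assms by (simp add: block_vectors_def)
  assume i: "i \<in> {1..d}" "i \<noteq> k"
  have mono: "(\<Sum>j=1..x. r j) \<le> (\<Sum>j=1..y. r j)" if "x \<le> y" for x y :: nat
    using that by (intro sum_mono2) auto
  have "s \<notin> {(\<Sum>j=1..i-1. r j)<..(\<Sum>j=1..i. r j)}"
  proof (cases "i < k")
    case True
    then have "i \<le> k - 1" by simp
    from mono[OF this] show ?thesis using s by simp
  next
    case False
    then have "k \<le> i - 1" using i by simp
    from mono[OF this] show ?thesis using s by simp
  qed
  then show "block_vectors d r u s i = 0" using i by (auto simp: block_vectors_def)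
qed

theorem theorem3:
  shows "\<exists>c::real. c > 0 \<and>
    (\<forall>(d::nat) (n::nat) (F::real measure) (a::nat \<Rightarrow> nat \<Rightarrow> real)
      (\<tau>::nat \<Rightarrow> real) (\<delta>::nat \<Rightarrow> real) (q::nat \<Rightarrow> real).
      1 \<le> d \<and> 1 \<le> n \<and> real_distribution F \<and> diff_tail F 1 > 0 \<and>
      (\<forall>k\<in>{1..n}. a k \<in> space (Rd d)) \<and> (\<exists>k\<in>{1..n}. \<exists>i\<in>{1..d}. a k i \<noteq> 0) \<and>
      (\<forall>j\<in>{1..d}. 0 \<le> \<delta> j \<and> \<delta> j \<le> \<tau> j) \<and>
      (\<forall>j\<in>{1..d}. q j = conc_fun (coord_law F d n a j) (\<tau> j))
      \<longrightarrow>
      (\<exists>(r::nat \<Rightarrow> nat) (u::nat \<Rightarrow> nat \<Rightarrow> real).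
        (\<forall>j\<in>{1..d}. 1 \<le> r j) \<and>
        ereal (real (\<Sum>j=1..d. r j))
          \<le> ereal c * (\<Sum>j=1..d. abs_log (q j) + log_ratio (\<tau> j) (\<delta> j) + 1) \<and>
        ereal (diff_tail F 1 *
            Mstar d n a (space (Rd d) - Pi\<^sub>E {1..d} (\<lambda>j. nbhd (K1_real (r j) (u j)) (\<delta> j))))
          \<le> ereal c * (\<Sum>j=1..d. (abs_log (q j) + log_ratio (\<tau> j) (\<delta> j) + 1) ^ 3) \<and>
        (\<exists>v::nat \<Rightarrow> nat \<Rightarrow> real.
          (\<forall>s\<in>{1..(\<Sum>j=1..d. r j)}. v s \<in> space (Rd d)) \<and>
          Pi\<^sub>E {1..d} (\<lambda>j. K1_real (r j) (u j)) = K1 d (\<Sum>j=1..d. r j) v \<and>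
          (\<forall>k\<in>{1..d}. \<forall>s. (\<Sum>j=1..k-1. r j) < s \<and> s \<le> (\<Sum>j=1..k. r j) \<longrightarrow>
             v s k = u k (s - (\<Sum>j=1..k-1. r j)) \<and> v s k \<noteq> 0 \<and>
             (\<forall>i\<in>{1..d}. i \<noteq> k \<longrightarrow> v s i = 0)))))"
proof (rule exI[of _ 272], intro conjI allI impI)
  fix d n :: nat and F :: "real measure" and a :: "nat \<Rightarrow> nat \<Rightarrow> real" and \<tau> \<delta> q :: "nat \<Rightarrow> real"
  assume "1 \<le> d \<and> 1 \<le> n \<and> real_distribution F \<and> diff_tail F 1 > 0 \<and>
      (\<forall>k\<in>{1..n}. a k \<in> space (Rd d)) \<and> (\<exists>k\<in>{1..n}. \<exists>i\<in>{1..d}. a k i \<noteq> 0) \<and>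
      (\<forall>j\<in>{1..d}. 0 \<le> \<delta> j \<and> \<delta> j \<le> \<tau> j) \<and>
      (\<forall>j\<in>{1..d}. q j = conc_fun (coord_law F d n a j) (\<tau> j))"
  then have F: "real_distribution F" and p: "0 < diff_tail F 1"
    and a: "\<And>k. k \<in> {1..n} \<Longrightarrow> a k \<in> space (Rd d)"
    and \<delta>: "\<And>j. j \<in> {1..d} \<Longrightarrow> 0 \<le> \<delta> j" "\<And>j. j \<in> {1..d} \<Longrightarrow> \<delta> j \<le> \<tau> j"
    and q: "\<And>j. j \<in> {1..d} \<Longrightarrow> q j = conc_fun (coord_law F d n a j) (\<tau> j)"
    by blast+
  let ?L = "\<lambda>j. abs_log (q j) + log_ratio (\<tau> j) (\<delta> j) + 1"
  have L0: "0 \<le> ?L j" if "j \<in> {1..d}" for j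
  proof -
    have "0 \<le> abs_log (q j)" by (simp add: abs_log_def)
    moreover have "0 \<le> log_ratio (\<tau> j) (\<delta> j)" using \<delta>[OF that] by (auto simp: log_ratio_def)
    ultimately show ?thesis by simp
  qed
  define good where "good j r u \<longleftrightarrow> 1 \<le> r \<and> (\<forall>s\<in>{1..r}. u s \<noteq> 0) \<and> ereal (real r) \<le> ereal 272 * ?L j \<and>
      ereal (diff_tail F 1 * (2 * real (card {k\<in>{1..n}. a k j \<notin> nbhd (K1_real r u) (\<delta> j)}))) \<le> ereal 272 * ?L j ^ 3"
    for j r u
  have "\<exists>r u. good j r u" if j: "j \<in> {1..d}" for j
    unfolding good_def
  proof (rule coordinate_structure[OF F p \<delta>[OF j]])
    have "coord_law F d n a j = distr (Pi\<^sub>M {1..n} (\<lambda>_. F)) borel (\<lambda>x. \<Sum>k=1..n. x k * a k j)"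
      using j by (simp add: coord_law_def weighted_sum_def)
    then show "?L j = abs_log (conc_fun (distr (Pi\<^sub>M {1..n} (\<lambda>_. F)) borel (\<lambda>x. \<Sum>k=1..n. x k * a k j)) (\<tau> j))
        + log_ratio (\<tau> j) (\<delta> j) + 1"
      by (simp add: q[OF j])
  qed
  then have "\<forall>j\<in>{1..d}. \<exists>ru. good j (fst ru) (snd ru)" by simp
  then obtain ru where ru: "\<forall>j\<in>{1..d}. good j (fst (ru j)) (snd (ru j))" by (rule bchoice[THEN exE])
  define r u where "r j = fst (ru j)" and "u j = snd (ru j)" for j
  have good: "good j (r j) (u j)" if "j \<in> {1..d}" for j using ru that by (simp add: r_def u_def)
  have r1: "\<And>j. j \<in> {1..d} \<Longrightarrow> 1 \<le> r j" and u: "\<And>j s. j \<in> {1..d} \<Longrightarrow> s \<in> {1..r j} \<Longrightarrow> u j s \<noteq> 0"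
    and rank: "\<And>j. j \<in> {1..d} \<Longrightarrow> ereal (real (r j)) \<le> ereal 272 * ?L j"
    and far: "\<And>j. j \<in> {1..d} \<Longrightarrow> ereal (diff_tail F 1 *
        (2 * real (card {k\<in>{1..n}. a k j \<notin> nbhd (K1_real (r j) (u j)) (\<delta> j)}))) \<le> ereal 272 * ?L j ^ 3"
    using good unfolding good_def by blast+
  have "ereal (real (\<Sum>j=1..d. r j)) = (\<Sum>j=1..d. ereal (real (r j)))" by simp
  also have "\<dots> \<le> (\<Sum>j=1..d. ereal 272 * ?L j)" by (intro sum_mono rank)
  also have "\<dots> = ereal 272 * (\<Sum>j=1..d. ?L j)" by (rule sum_ereal_right_distrib[symmetric]) (rule L0)
  finally have R: "ereal (real (\<Sum>j=1..d. r j)) \<le> ereal 272 * (\<Sum>j=1..d. ?L j)" .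
  let ?E = "space (Rd d) - Pi\<^sub>E {1..d} (\<lambda>j. nbhd (K1_real (r j) (u j)) (\<delta> j))"
  have "diff_tail F 1 * Mstar d n a ?E
      \<le> diff_tail F 1 * (\<Sum>j=1..d. 2 * real (card {k\<in>{1..n}. a k j \<notin> nbhd (K1_real (r j) (u j)) (\<delta> j)}))"
    using p by (intro mult_left_mono Mstar_le_sum_card a) auto
  then have "ereal (diff_tail F 1 * Mstar d n a ?E) \<le> (\<Sum>j=1..d. ereal (diff_tail F 1 *
      (2 * real (card {k\<in>{1..n}. a k j \<notin> nbhd (K1_real (r j) (u j)) (\<delta> j)}))))"
    unfolding sum_ereal sum_distrib_left by simp
  also have "\<dots> \<le> (\<Sum>j=1..d. ereal 272 * ?L j ^ 3)" by (intro sum_mono far)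
  also have "\<dots> = ereal 272 * (\<Sum>j=1..d. ?L j ^ 3)"
    by (rule sum_ereal_right_distrib[symmetric]) (intro zero_le_power_ereal L0)
  finally have E: "ereal (diff_tail F 1 * Mstar d n a ?E) \<le> ereal 272 * (\<Sum>j=1..d. ?L j ^ 3)" .
  have block: "block_vectors d r u s k = u k (s - (\<Sum>j=1..k-1. r j)) \<and> block_vectors d r u s k \<noteq> 0 \<and>
      (\<forall>i\<in>{1..d}. i \<noteq> k \<longrightarrow> block_vectors d r u s i = 0)"
    if k: "k \<in> {1..d}" and s: "(\<Sum>j=1..k-1. r j) < s \<and> s \<le> (\<Sum>j=1..k. r j)" for k s
  proof -
    have "{1..k} = insert k {1..k-1}" using k by auto
    then have "(\<Sum>j=1..k. r j) = r k + (\<Sum>j=1..k-1. r j)" using k by (subst \<open>{1..k} = _\<close>, subst sum.insert) auto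
    then have "s - (\<Sum>j=1..k-1. r j) \<in> {1..r k}" using s by auto
    then show ?thesis using block_vectors_block[OF k, where r = r and s = s and u = u] s u[OF k] by auto
  qed
  have space: "block_vectors d r u s \<in> space (Rd d)" for s
    by (simp add: block_vectors_def space_PiM)
  show "\<exists>(r::nat \<Rightarrow> nat) (u::nat \<Rightarrow> nat \<Rightarrow> real).
        (\<forall>j\<in>{1..d}. 1 \<le> r j) \<and>
        ereal (real (\<Sum>j=1..d. r j)) \<le> ereal 272 * (\<Sum>j=1..d. ?L j) \<and>
        ereal (diff_tail F 1 *
            Mstar d n a (space (Rd d) - Pi\<^sub>E {1..d} (\<lambda>j. nbhd (K1_real (r j) (u j)) (\<delta> j))))
          \<le> ereal 272 * (\<Sum>j=1..d. ?L j ^ 3) \<and>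
        (\<exists>v::nat \<Rightarrow> nat \<Rightarrow> real.
          (\<forall>s\<in>{1..(\<Sum>j=1..d. r j)}. v s \<in> space (Rd d)) \<and>
          Pi\<^sub>E {1..d} (\<lambda>j. K1_real (r j) (u j)) = K1 d (\<Sum>j=1..d. r j) v \<and>
          (\<forall>k\<in>{1..d}. \<forall>s. (\<Sum>j=1..k-1. r j) < s \<and> s \<le> (\<Sum>j=1..k. r j) \<longrightarrow>
             v s k = u k (s - (\<Sum>j=1..k-1. r j)) \<and> v s k \<noteq> 0 \<and>
             (\<forall>i\<in>{1..d}. i \<noteq> k \<longrightarrow> v s i = 0)))"
    by (intro exI[of _ r] exI[of _ u] exI[of _ "block_vectors d r u"] conjI ballI allI impI
        r1 R E space PiE_K1_real_eq_K1) (use block in blast)+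
qed simp

end
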